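(* The Noether symmetry group of the equation $\Delta_{H^1}u+u=0$ is $G_f\cup\{W_\beta\}$, where $G_f=\{T,R,\tilde X,\tilde Y\}$ with $$T=\frac{\partial}{\partial t},\quad R=y\frac{\partial}{\partial x}-x\frac{\partial}{\partial y},\quad \tilde X=\frac{\partial}{\partial x}-2y\frac{\partial}{\partial t},\quad \tilde Y=\frac{\partial}{\partial y}+2x\frac{\partial}{\partial t},$$ and $W_\beta=\beta(x,y,t)\frac{\partial}{\partial u}$ where $\beta$ satisfies $\Delta_{H^1}\beta+\beta=0$. That is, a Lie point symmetry of this equation is a Noether symmetry if and only if it belongs to the Lie algebra generated by $T,R,\tilde X,\tilde Y$ and all $W_\beta$ with $\Delta_{H^1}\beta+\beta=0$.
   Context: Coordinates on $\mathbb{R}^3$ (the Heisenberg group $H^1$) are $(x^1,x^2,x^3)=(x,y,t)$, and $u=u(x,y,t)$ is a smooth real-valued function. The Kohn-Laplace operator is $$\Delta_{H^1}u=u_{xx}+u_{yy}+4(x^2+y^2)u_{tt}+4y\,u_{xt}-4x\,u_{yt}.$$ The equation $\Delta_{H^1}u+u=0$ is the Euler-Lagrange equation of the Lagrangian $$\mathcal{L}=\tfrac12u_x^2+\tfrac12u_y^2+2(x^2+y^2)u_t^2+2y\,u_xu_t-2x\,u_yu_t-\tfrac12u^2.$$ A Lie point symmetry is a vector field $S=\xi^i(x,y,t,u)\frac{\partial}{\partial x^i}+\eta(x,y,t,u)\frac{\partial}{\partial u}$ (sum over $i=1,2,3$) whose second prolongation annihilates $\Delta_{H^1}u+u$ whenever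 $\Delta_{H^1}u+u=0$. Its first prolongation is $S^{(1)}=S+\eta^{(1)}_i\frac{\partial}{\partial u_i}$, $\eta^{(1)}_i=D_i\eta-(D_i\xi^j)u_j$, where $D_i$ is the total derivative with respect to $x^i$ and $u_i=\partial u/\partial x^i$. A Lie point symmetry $S$ is a Noether symmetry if there exists $\varphi=(\varphi^1,\varphi^2,\varphi^3)$, with components functions of $x,y,t,u$ and derivatives of $u$, such that $S^{(1)}\mathcal{L}+\mathcal{L}\,D_i\xi^i=D_i\varphi^i$ identically. Symmetry groups are identified with the infinitesimal generators that generate them. By the known group classification, the Lie point symmetries of $\Delta_{H^1}u+u=0$ are the linear combinations of $T,R,\tilde X,\tilde Y$, $U=u\frac{\partial}{\partial u}$ and the $W_\beta$ with $\Delta_{H^1}\beta+\beta=0$. *)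

theory Defs
  imports "HOL-Analysis.Analysis" "HOL-Library.Multiset"
begin

section \<open>Jet space and differential functions\<close>

text \<open>
  Coordinates on the infinite jet space of real functions \<open>u\<close> on \<open>\<real>\<^sup>3\<close>:
  \<open>Indep 1, Indep 2, Indep 3\<close> are \<open>x, y, t\<close>, and \<open>Deriv J\<close> is the partial derivative of \<open>u\<close>
  indexed by the multiset \<open>J\<close>; so \<open>Deriv {#}\<close> is \<open>u\<close> itself and \<open>Deriv {#1,3#}\<close> is
  \<open>u_xt\<close>.  (In the index type \<open>3\<close> one has \<open>3 = 0\<close>.)
\<close>

datatype jet_coord = Indep 3 | Deriv "3 multiset"

type_synonym jet = "jet_coord \<Rightarrow> real"

abbreviation xc :: "jet \<Rightarrow> real" where "xc z \<equiv> z (Indep 1)"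
abbreviation yc :: "jet \<Rightarrow> real" where "yc z \<equiv> z (Indep 2)"
abbreviation uc :: "jet \<Rightarrow> real" where "uc z \<equiv> z (Deriv {#})"

definition pd :: "jet_coord \<Rightarrow> (jet \<Rightarrow> real) \<Rightarrow> jet \<Rightarrow> real" where
  "pd c F z = deriv (\<lambda>s. F (z(c := s))) (z c)"

definition depends_on :: "jet_coord set \<Rightarrow> (jet \<Rightarrow> real) \<Rightarrow> bool" where
  "depends_on V F \<longleftrightarrow> (\<forall>z z'. (\<forall>c\<in>V. z c = z' c) \<longrightarrow> F z = F z')"

text \<open>
  The jet space carries the product topology.  For a function of finitely many coordinates,
  \<open>jet_smooth\<close> is ordinary \<open>C\<^sup>\<infinity>\<close> smoothness: all iterated partial derivatives exist and are
  continuous.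
\<close>

definition jet_smooth :: "(jet \<Rightarrow> real) \<Rightarrow> bool" where
  "jet_smooth F \<longleftrightarrow>
     (\<forall>cs. continuous_on UNIV (foldr pd cs F) \<and>
           (\<forall>c z. (\<lambda>s. foldr pd cs F (z(c := s))) differentiable (at (z c))))"

definition differential_function :: "(jet \<Rightarrow> real) \<Rightarrow> bool" where
  "differential_function F \<longleftrightarrow> jet_smooth F \<and> (\<exists>V. finite V \<and> depends_on V F)"

text \<open>Smooth functions of \<open>(x,y,t)\<close> and of \<open>(x,y,t,u)\<close>, respectively.\<close>

definition base_function :: "(jet \<Rightarrow> real) \<Rightarrow> bool" where
  "base_function F \<longleftrightarrow> jet_smooth F \<and> depends_on (range Indep) F"

definition point_function :: "(jet \<Rightarrow> real) \<Rightarrow> bool" where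
  "point_function F \<longleftrightarrow> jet_smooth F \<and> depends_on (insert (Deriv {#}) (range Indep)) F"

text \<open>
  Total derivative with respect to the \<open>i\<close>-th independent variable.  For a differential function
  only finitely many of the \<open>pd (Deriv J) F\<close> are nonzero, so the sum is a finite one.
\<close>

definition total_deriv :: "3 \<Rightarrow> (jet \<Rightarrow> real) \<Rightarrow> jet \<Rightarrow> real" where
  "total_deriv i F z =
     pd (Indep i) F z +
     (\<Sum>J | pd (Deriv J) F z \<noteq> 0. z (Deriv (add_mset i J)) * pd (Deriv J) F z)"

section \<open>Vector fields, Lie brackets and prolongations\<close>

text \<open>
  \<open>VField \<xi> \<eta>\<close> is the vector field with components \<open>\<xi> i\<close> along \<open>\<partial>/\<partial>x\<^sup>i\<close> and \<open>\<eta>\<close> along \<open>\<partial>/\<partial>u\<close>.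
  That the components depend on \<open>(x,y,t,u)\<close> only and are smooth is required by
  \<open>point_vector_field\<close> below.
\<close>

datatype vector_field = VField (xi: "3 \<Rightarrow> jet \<Rightarrow> real") (eta: "jet \<Rightarrow> real")

instantiation vector_field :: real_vector
begin

definition zero_vector_field :: vector_field where
  "0 = VField (\<lambda>i z. 0) (\<lambda>z. 0)"

definition plus_vector_field :: "vector_field \<Rightarrow> vector_field \<Rightarrow> vector_field" where
  "S + S' = VField (\<lambda>i z. xi S i z + xi S' i z) (\<lambda>z. eta S z + eta S' z)"

definition uminus_vector_field :: "vector_field \<Rightarrow> vector_field" where
  "- S = VField (\<lambda>i z. - xi S i z) (\<lambda>z. - eta S z)"

definition minus_vector_field :: "vector_field \<Rightarrow> vector_field \<Rightarrow> vector_field" where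
  "S - S' = VField (\<lambda>i z. xi S i z - xi S' i z) (\<lambda>z. eta S z - eta S' z)"

definition scaleR_vector_field :: "real \<Rightarrow> vector_field \<Rightarrow> vector_field" where
  "a *\<^sub>R S = VField (\<lambda>i z. a * xi S i z) (\<lambda>z. a * eta S z)"

instance
  by standard
    (simp_all add: zero_vector_field_def plus_vector_field_def uminus_vector_field_def
      minus_vector_field_def scaleR_vector_field_def vector_field.expand algebra_simps)

end

definition point_vector_field :: "vector_field \<Rightarrow> bool" where
  "point_vector_field S \<longleftrightarrow> (\<forall>i. point_function (xi S i)) \<and> point_function (eta S)"

definition vf_apply :: "vector_field \<Rightarrow> (jet \<Rightarrow> real) \<Rightarrow> jet \<Rightarrow> real" where
  "vf_apply S F z = (\<Sum>i\<in>UNIV. xi S i z * pd (Indep i) F z) + eta S z * pd (Deriv {#}) F z"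

definition lie_bracket :: "vector_field \<Rightarrow> vector_field \<Rightarrow> vector_field" where
  "lie_bracket S S' =
     VField (\<lambda>i z. vf_apply S (xi S' i) z - vf_apply S' (xi S i) z)
            (\<lambda>z. vf_apply S (eta S') z - vf_apply S' (eta S) z)"

definition lie_subalgebra :: "vector_field set \<Rightarrow> bool" where
  "lie_subalgebra A \<longleftrightarrow> subspace A \<and> (\<forall>S\<in>A. \<forall>S'\<in>A. lie_bracket S S' \<in> A)"

definition lie_algebra_generated :: "vector_field set \<Rightarrow> vector_field set" where
  "lie_algebra_generated G = lie_subalgebra hull G"

definition eta1 :: "vector_field \<Rightarrow> 3 \<Rightarrow> jet \<Rightarrow> real" where
  "eta1 S i z = total_deriv i (eta S) z - (\<Sum>j\<in>UNIV. total_deriv i (xi S j) z * z (Deriv {#j#}))"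

definition eta2 :: "vector_field \<Rightarrow> 3 \<Rightarrow> 3 \<Rightarrow> jet \<Rightarrow> real" where
  "eta2 S i j z =
     total_deriv j (eta1 S i) z - (\<Sum>k\<in>UNIV. total_deriv j (xi S k) z * z (Deriv {#i, k#}))"

definition pr1 :: "vector_field \<Rightarrow> (jet \<Rightarrow> real) \<Rightarrow> jet \<Rightarrow> real" where
  "pr1 S F z = vf_apply S F z + (\<Sum>i\<in>UNIV. eta1 S i z * pd (Deriv {#i#}) F z)"

text \<open>
  \<open>u_ij = u_ji\<close> is a single jet coordinate, so each unordered pair \<open>i, j\<close> contributes once.
\<close>

definition pr2 :: "vector_field \<Rightarrow> (jet \<Rightarrow> real) \<Rightarrow> jet \<Rightarrow> real" where
  "pr2 S F z = pr1 S F z + (\<Sum>i\<in>UNIV. \<Sum>j\<in>{i..}. eta2 S i j z * pd (Deriv {#i, j#}) F z)"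

text \<open>Symmetries of the second-order equation \<open>F = 0\<close>, respectively with first-order Lagrangian \<open>L\<close>.\<close>

definition lie_point_symmetry :: "(jet \<Rightarrow> real) \<Rightarrow> vector_field \<Rightarrow> bool" where
  "lie_point_symmetry F S \<longleftrightarrow>
     point_vector_field S \<and> (\<forall>z. F z = 0 \<longrightarrow> pr2 S F z = 0)"

definition noether_symmetry ::
    "(jet \<Rightarrow> real) \<Rightarrow> (jet \<Rightarrow> real) \<Rightarrow> vector_field \<Rightarrow> bool" where
  "noether_symmetry F L S \<longleftrightarrow>
     lie_point_symmetry F S \<and>
     (\<exists>\<phi> :: 3 \<Rightarrow> jet \<Rightarrow> real. (\<forall>i. differential_function (\<phi> i)) \<and>
        (\<forall>z. pr1 S L z + L z * (\<Sum>i\<in>UNIV. total_deriv i (xi S i) z) =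
             (\<Sum>i\<in>UNIV. total_deriv i (\<phi> i) z)))"

section \<open>The equation on the Heisenberg group\<close>

text \<open>
  Written with total derivatives, the operator applies both to functions of \<open>(x,y,t)\<close>, where these
  are the usual partial derivatives, and to the jet coordinate \<open>u\<close>.
\<close>

definition kohn_laplace :: "(jet \<Rightarrow> real) \<Rightarrow> jet \<Rightarrow> real" where
  "kohn_laplace F z =
     total_deriv 1 (total_deriv 1 F) z + total_deriv 2 (total_deriv 2 F) z
     + 4 * ((xc z)\<^sup>2 + (yc z)\<^sup>2) * total_deriv 3 (total_deriv 3 F) z
     + 4 * yc z * total_deriv 3 (total_deriv 1 F) z
     - 4 * xc z * total_deriv 3 (total_deriv 2 F) z"

definition heisenberg_eq :: "jet \<Rightarrow> real" where
  "heisenberg_eq z = kohn_laplace uc z + uc z"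

lemma pd_coord: "pd c (\<lambda>z. z d) z = (if c = d then 1 else 0)"
  by (simp add: pd_def)

lemma total_deriv_Deriv: "total_deriv i (\<lambda>z. z (Deriv J)) = (\<lambda>z. z (Deriv (add_mset i J)))"
  by (rule ext) (simp add: total_deriv_def pd_coord cong: if_cong)

lemma heisenberg_eq_explicit:
  "heisenberg_eq z =
     z (Deriv {#1, 1#}) + z (Deriv {#2, 2#}) + 4 * ((xc z)\<^sup>2 + (yc z)\<^sup>2) * z (Deriv {#3, 3#})
     + 4 * yc z * z (Deriv {#1, 3#}) - 4 * xc z * z (Deriv {#2, 3#}) + uc z"
  by (simp add: heisenberg_eq_def kohn_laplace_def total_deriv_Deriv add_mset_commute)

definition heisenberg_lagrangian :: "jet \<Rightarrow> real" where
  "heisenberg_lagrangian z =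
     1/2 * (z (Deriv {#1#}))\<^sup>2 + 1/2 * (z (Deriv {#2#}))\<^sup>2
     + 2 * ((xc z)\<^sup>2 + (yc z)\<^sup>2) * (z (Deriv {#3#}))\<^sup>2
     + 2 * yc z * z (Deriv {#1#}) * z (Deriv {#3#})
     - 2 * xc z * z (Deriv {#2#}) * z (Deriv {#3#})
     - 1/2 * (uc z)\<^sup>2"

text \<open>\<open>vf a b c h\<close> is \<open>a \<partial>/\<partial>x + b \<partial>/\<partial>y + c \<partial>/\<partial>t + h \<partial>/\<partial>u\<close>.\<close>

definition vf ::
    "(jet \<Rightarrow> real) \<Rightarrow> (jet \<Rightarrow> real) \<Rightarrow> (jet \<Rightarrow> real) \<Rightarrow> (jet \<Rightarrow> real) \<Rightarrow> vector_field" where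
  "vf a b c h = VField (\<lambda>i. if i = 1 then a else if i = 2 then b else c) h"

definition T_field :: vector_field where
  "T_field = vf (\<lambda>z. 0) (\<lambda>z. 0) (\<lambda>z. 1) (\<lambda>z. 0)"

definition R_field :: vector_field where
  "R_field = vf (\<lambda>z. yc z) (\<lambda>z. - xc z) (\<lambda>z. 0) (\<lambda>z. 0)"

definition X_tilde :: vector_field where
  "X_tilde = vf (\<lambda>z. 1) (\<lambda>z. 0) (\<lambda>z. - 2 * yc z) (\<lambda>z. 0)"

definition Y_tilde :: vector_field where
  "Y_tilde = vf (\<lambda>z. 0) (\<lambda>z. 1) (\<lambda>z. 2 * xc z) (\<lambda>z. 0)"

definition W_field :: "(jet \<Rightarrow> real) \<Rightarrow> vector_field" where
  "W_field \<beta> = vf (\<lambda>z. 0) (\<lambda>z. 0) (\<lambda>z. 0) \<beta>"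

end

(*
  With X = d/dx + 2y d/dt and Y = d/dy - 2x d/dt one has Delta = X^2 + Y^2 and [X, Y] = -4 d/dt.
  Evaluating the prolonged symmetry condition on free second-order jets shows that xi^i does not
  involve u, that eta = alpha u + beta, and that (xi^i) is the contact field of a potential theta:
  X theta = 4 xi^2 and Y theta = -4 xi^1, with X^2 theta = Y^2 theta and XY theta = - YX theta.
  Commuting X and Y through these two equations gives d/dt (X^2 theta) = 0, and the equation for
  alpha then forces d theta/dt = 0.  Hence (xi^i) is a combination of T, R, X~, Y~, alpha is a
  constant kappa, and beta solves the equation.

  Such a field with kappa = 0 is a Noether symmetry, with phi^i = u a^{ij} d beta/dx^j where
  a^{ij} is the symbol of Delta.  For general kappa the left-hand side of the Noether identity
  changes by 2 kappa L, so kappa = 0 follows once L is not a total divergence.  If it were, the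
  integral of L[u] would vanish for every u all of whose derivatives up to a high order vanish on
  the boundary of a box; products u = k(x) k(y) k(d t) with k(s) = (1 - s^2)^n and d = 1, 2
  lead to a contradiction.
*)

theory Submission
  imports Defs
begin

section \<open>Calculus on the jet space\<close>

text \<open>In the frame the Lagrangian is ((X u)^2 + (Y u)^2 - u^2) / 2. The fields T, X~, Y~
  commute with X and Y, and R rotates the pair, which is why these four leave it invariant. The
  potential theta is the contact form dt - 2y dx + 2x dy, which annihilates X and Y, evaluated on
  the vector field. The equations for theta alone still admit the dilation (theta = 2t). It is the
  zero-order term u of the equation that removes it: this term enters the equation for alpha as -2 X
  xi^1, which is - d theta/dt. In the divergence argument the flux may involve derivatives of u of
  any order and need not vanish at u = 0. The first difficulty is met by choosing n only after the
  finitely many coordinates in the flux are known; polynomials with zeros of order n at the ends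
  then do the work of compactly supported functions. The second is met by subtracting the flux of
  the zero function. Stretching t by d multiplies the part of the integral without u_t by 1/d and
  the part with u_t^2 by d. A single d could allow an accidental cancellation between the two; two
  values of d cannot.\<close>

lemma pd_eqI:
  assumes "((\<lambda>s. F (z(c := s))) has_real_derivative D) (at (z c))"
  shows "pd c F z = D"
  using assms by (simp add: pd_def DERIV_imp_deriv)

lemma jet_smooth_continuous: "jet_smooth F \<Longrightarrow> continuous_on UNIV F"
  unfolding jet_smooth_def by (metis foldr.simps(1) id_apply)

lemma jet_smooth_differentiable:
  "jet_smooth F \<Longrightarrow> (\<lambda>s. F (z(c := s))) differentiable (at (z c))"
  unfolding jet_smooth_def by (metis foldr.simps(1) id_apply)

lemma jet_smooth_pd [simp, intro]: "jet_smooth F \<Longrightarrow> jet_smooth (pd c F)"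
  unfolding jet_smooth_def
proof (intro allI)
  fix cs
  assume *: "\<forall>cs. continuous_on UNIV (foldr pd cs F) \<and>
         (\<forall>c z. (\<lambda>s. foldr pd cs F (z(c := s))) differentiable at (z c))"
  show "continuous_on UNIV (foldr pd cs (pd c F)) \<and>
         (\<forall>ca z. (\<lambda>s. foldr pd cs (pd c F) (z(ca := s))) differentiable at (z ca))"
    using *[rule_format, of "cs @ [c]"] by simp
qed

lemma jet_smooth_DERIV:
  assumes "jet_smooth F"
  shows "((\<lambda>s. F (z(c := s))) has_real_derivative pd c F (z(c := s0))) (at s0)"
  using jet_smooth_differentiable[OF assms, where c = c and z = "z(c := s0)"]
  by (auto simp: pd_def dest: DERIV_deriv_iff_real_differentiable[THEN iffD2])

lemma jet_smooth_DERIV':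
  assumes "jet_smooth F"
  shows "((\<lambda>s. F (z(c := s))) has_real_derivative pd c F z) (at (z c))"
  using jet_smooth_DERIV[OF assms, of z c "z c"] by simp

section \<open>Closure of smoothness under algebraic operations\<close>

lemma jet_smooth_coinduct:
  assumes "P F"
    and "\<And>F. P F \<Longrightarrow> continuous_on UNIV F"
    and "\<And>F c z. P F \<Longrightarrow> (\<lambda>s. F (z(c := s))) differentiable (at (z c))"
    and "\<And>F c. P F \<Longrightarrow> P (pd c F)"
  shows "jet_smooth F"
  unfolding jet_smooth_def
proof
  fix cs
  have "P (foldr pd cs F)" by (induction cs) (use assms in auto)
  then show "continuous_on UNIV (foldr pd cs F) \<and>
     (\<forall>c z. (\<lambda>s. foldr pd cs F (z(c := s))) differentiable (at (z c)))"
    using assms by blast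
qed

lemma pd_const [simp]: "pd c (\<lambda>z. k) = (\<lambda>z. 0)"
  by (rule ext, rule pd_eqI) simp

lemma pd_coordinate [simp]: "pd c (\<lambda>z. z d) = (\<lambda>z. if c = d then 1 else 0)"
  by (rule ext) (rule pd_coord)

lemma jet_smooth_const [simp, intro]: "jet_smooth (\<lambda>z. k)"
  by (rule jet_smooth_coinduct[where P = "\<lambda>F. \<exists>k. F = (\<lambda>z. k)"]) auto

lemma jet_smooth_coordinate [simp, intro]: "jet_smooth (\<lambda>z. z d)"
proof (rule jet_smooth_coinduct[where P = "\<lambda>F. F = (\<lambda>z. z d) \<or> (\<exists>k. F = (\<lambda>z. k))"], goal_cases)
  case (3 F c z) then show ?case by (cases "c = d") auto
qed auto

text \<open>Sums of products form the class closed under partial derivatives to which coinduction is applied.\<close>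

definition sum_prod :: "((jet \<Rightarrow> real) \<times> (jet \<Rightarrow> real)) list \<Rightarrow> jet \<Rightarrow> real" where
  "sum_prod ps z = (\<Sum>(f, g)\<leftarrow>ps. f z * g z)"

lemma jet_smooth_sum_prod:
  assumes "\<forall>(f, g) \<in> set ps. jet_smooth f \<and> jet_smooth g"
  shows "jet_smooth (sum_prod ps)"
proof (rule jet_smooth_coinduct[where P = "\<lambda>F. \<exists>ps. (\<forall>(f, g) \<in> set ps. jet_smooth f \<and> jet_smooth g) \<and> F = sum_prod ps"], goal_cases)
  case 1 then show ?case using assms by blast
next
  case (2 F)
  then obtain ps where ps: "\<forall>(f, g) \<in> set ps. jet_smooth f \<and> jet_smooth g" "F = sum_prod ps" by blast
  from ps(1) have "continuous_on UNIV (sum_prod ps)" unfolding sum_prod_def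
    by (induction ps) (auto intro!: continuous_intros dest: jet_smooth_continuous)
  then show ?case by (simp add: ps(2))
next
  \<comment> \<open>The product rule splits each pair into two, so the derivative is again a
    \<open>sum_prod\<close>. This gives both differentiability and closure under
    \<open>pd\<close>.\<close>
  have D: "((\<lambda>s. sum_prod ps (z(c := s))) has_real_derivative
        sum_prod (concat (map (\<lambda>(f, g). [(pd c f, g), (f, pd c g)]) ps)) z) (at (z c))"
    if "\<forall>(f, g) \<in> set ps. jet_smooth f \<and> jet_smooth g" for ps c z
    using that
  proof (induction ps)
    case Nil then show ?case by (simp add: sum_prod_def)
  next
    case (Cons p ps)
    obtain f g where p: "p = (f, g)" by (cases p)
    have s: "jet_smooth f" "jet_smooth g" using Cons.prems p by auto
    have IH: "((\<lambda>s. sum_prod ps (z(c := s))) has_real_derivative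
        sum_prod (concat (map (\<lambda>(f, g). [(pd c f, g), (f, pd c g)]) ps)) z) (at (z c))"
      by (rule Cons.IH) (use Cons.prems in simp)
    have 1: "((\<lambda>s. f (z(c := s)) * g (z(c := s)) + sum_prod ps (z(c := s))) has_real_derivative
        (pd c f z * g (z(c := z c)) + pd c g z * f (z(c := z c))) +
        sum_prod (concat (map (\<lambda>(f, g). [(pd c f, g), (f, pd c g)]) ps)) z) (at (z c))"
      by (rule DERIV_add[OF DERIV_mult[OF jet_smooth_DERIV'[OF s(1), of z c] jet_smooth_DERIV'[OF s(2), of z c]] IH])
    have 2: "sum_prod (concat (map (\<lambda>(f, g). [(pd c f, g), (f, pd c g)]) (p # ps))) z =
        (pd c f z * g (z(c := z c)) + pd c g z * f (z(c := z c))) +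
        sum_prod (concat (map (\<lambda>(f, g). [(pd c f, g), (f, pd c g)]) ps)) z"
      by (simp add: p sum_prod_def)
    have 3: "sum_prod (p # ps) w = f w * g w + sum_prod ps w" for w
      by (simp add: p sum_prod_def)
    show ?case unfolding 2 3 by (rule 1)
  qed
  {
    case (3 F c z)
    then obtain ps where ps: "\<forall>(f, g) \<in> set ps. jet_smooth f \<and> jet_smooth g" "F = sum_prod ps" by blast
    show ?case unfolding ps(2) real_differentiable_def using D[OF ps(1)] by (rule exI)
  next
    case (4 F c)
    then obtain ps where ps: "\<forall>(f, g) \<in> set ps. jet_smooth f \<and> jet_smooth g" "F = sum_prod ps" by blast
    have "pd c F = sum_prod (concat (map (\<lambda>(f, g). [(pd c f, g), (f, pd c g)]) ps))"
      unfolding ps(2) by (rule ext, rule pd_eqI) (rule D[OF ps(1)])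
    moreover have "\<forall>(f, g) \<in> set (concat (map (\<lambda>(f, g). [(pd c f, g), (f, pd c g)]) ps)). jet_smooth f \<and> jet_smooth g"
      using ps(1) by fastforce
    ultimately show ?case by blast
  }
qed

lemma jet_smooth_mult [simp, intro]: "jet_smooth f \<Longrightarrow> jet_smooth g \<Longrightarrow> jet_smooth (\<lambda>z. f z * g z)"
  using jet_smooth_sum_prod[of "[(f, g)]"] by (simp add: sum_prod_def[abs_def])

lemma jet_smooth_add [simp, intro]: "jet_smooth f \<Longrightarrow> jet_smooth g \<Longrightarrow> jet_smooth (\<lambda>z. f z + g z)"
  using jet_smooth_sum_prod[of "[(f, \<lambda>_. 1), (g, \<lambda>_. 1)]"] by (simp add: sum_prod_def[abs_def])

lemma jet_smooth_minus [simp, intro]: "jet_smooth f \<Longrightarrow> jet_smooth (\<lambda>z. - f z)"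
  using jet_smooth_mult[of "\<lambda>_. -1" f] by simp

lemma jet_smooth_diff [simp, intro]: "jet_smooth f \<Longrightarrow> jet_smooth g \<Longrightarrow> jet_smooth (\<lambda>z. f z - g z)"
  using jet_smooth_add[of f "\<lambda>z. - g z"] by simp

lemma jet_smooth_power [simp, intro]: "jet_smooth f \<Longrightarrow> jet_smooth (\<lambda>z. f z ^ n)"
  by (induction n) auto

lemma jet_smooth_sum [simp, intro]: "(\<And>i. i \<in> I \<Longrightarrow> jet_smooth (f i)) \<Longrightarrow> jet_smooth (\<lambda>z. \<Sum>i\<in>I. f i z)"
  by (induction I rule: infinite_finite_induct) auto

lemma pd_add [simp]:
  "jet_smooth f \<Longrightarrow> jet_smooth g \<Longrightarrow> pd c (\<lambda>z. f z + g z) = (\<lambda>z. pd c f z + pd c g z)"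
  by (rule ext, rule pd_eqI) (auto intro!: derivative_eq_intros jet_smooth_DERIV')

lemma pd_mult [simp]:
  "jet_smooth f \<Longrightarrow> jet_smooth g \<Longrightarrow> pd c (\<lambda>z. f z * g z) = (\<lambda>z. pd c f z * g z + f z * pd c g z)"
  by (rule ext, rule pd_eqI) (auto intro!: derivative_eq_intros jet_smooth_DERIV')

lemma pd_minus [simp]: "jet_smooth f \<Longrightarrow> pd c (\<lambda>z. - f z) = (\<lambda>z. - pd c f z)"
  by (rule ext, rule pd_eqI) (auto intro!: derivative_eq_intros jet_smooth_DERIV')

lemma pd_diff [simp]:
  "jet_smooth f \<Longrightarrow> jet_smooth g \<Longrightarrow> pd c (\<lambda>z. f z - g z) = (\<lambda>z. pd c f z - pd c g z)"
  by (rule ext, rule pd_eqI) (auto intro!: derivative_eq_intros jet_smooth_DERIV')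

lemma pd_power2 [simp]:
  "jet_smooth f \<Longrightarrow> pd c (\<lambda>z. (f z)\<^sup>2) = (\<lambda>z. 2 * f z * pd c f z)"
  by (simp add: power2_eq_square mult.assoc)

lemma jet_smooth_divide [simp]: "jet_smooth f \<Longrightarrow> jet_smooth (\<lambda>z. f z / k)"
  unfolding divide_inverse by simp

lemma pd_divide [simp]: "jet_smooth f \<Longrightarrow> pd c (\<lambda>z. f z / k) = (\<lambda>z. pd c f z / k)"
  unfolding divide_inverse by simp

section \<open>Symmetry of mixed partial derivatives\<close>

text \<open>
  Applied with \<open>c\<close> and \<open>d\<close> exchanged, the same second difference yields the other mixed derivative;
  letting \<open>h\<close> tend to \<open>0\<close> proves \<open>pd_commute\<close>.
\<close>

lemma second_difference:
  assumes F: "jet_smooth F" and h: "h > 0" and cd: "c \<noteq> d"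
  shows "\<exists>a b. s < a \<and> a < s + h \<and> t < b \<and> b < t + h \<and>
    F (z(c := s + h, d := t + h)) - F (z(c := s, d := t + h))
    - F (z(c := s + h, d := t)) + F (z(c := s, d := t)) = h\<^sup>2 * pd d (pd c F) (z(c := a, d := b))"
proof -
  \<comment> \<open>The increment in direction \<open>d\<close> as a function of the
    \<open>c\<close> coordinate: one mean value theorem for \<open>G\<close> in \<open>c\<close>,
    then one in \<open>d\<close>.\<close>
  define G where "G r = F ((z(d := t + h))(c := r)) - F ((z(d := t))(c := r))" for r
  have "\<exists>a>s. a < s + h \<and> G (s + h) - G s = (s + h - s) *
      (pd c F ((z(d := t + h))(c := a)) - pd c F ((z(d := t))(c := a)))"
    unfolding G_def
    by (rule MVT2, use h in simp) (rule DERIV_diff; rule jet_smooth_DERIV[OF F])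
  then obtain a where a: "s < a" "a < s + h"
    "G (s + h) - G s = h * (pd c F ((z(c := a))(d := t + h)) - pd c F ((z(c := a))(d := t)))"
    using cd by (auto simp: fun_upd_twist)
  have "\<exists>b>t. b < t + h \<and> pd c F ((z(c := a))(d := t + h)) - pd c F ((z(c := a))(d := t)) =
      (t + h - t) * pd d (pd c F) ((z(c := a))(d := b))"
    by (rule MVT2, use h in simp) (rule jet_smooth_DERIV[OF jet_smooth_pd[OF F]])
  then obtain b where b: "t < b" "b < t + h"
    "pd c F ((z(c := a))(d := t + h)) - pd c F ((z(c := a))(d := t)) = h * pd d (pd c F) (z(c := a, d := b))"
    by auto
  have "G (s + h) - G s = h\<^sup>2 * pd d (pd c F) (z(c := a, d := b))"
    using a(3) b(3) by (simp add: power2_eq_square)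
  then show ?thesis using a b cd by (intro exI[of _ a] exI[of _ b]) (simp add: G_def fun_upd_twist)
qed

lemma continuous_on_fun_upd2:
  assumes "continuous_on UNIV (G :: jet \<Rightarrow> real)"
  shows "continuous_on UNIV (\<lambda>p. G (z(c := fst p, d := snd p)))"
proof (rule continuous_on_compose2[OF assms])
  show "continuous_on UNIV (\<lambda>p. z(c := fst p, d := snd p))"
  proof (rule continuous_on_coordinatewise_then_product)
    fix i show "continuous_on UNIV (\<lambda>p. (z(c := fst p, d := snd p)) i)"
      by (cases "i = d"; cases "i = c") (auto intro!: continuous_intros)
  qed
qed simp

lemma pd_commute:
  assumes F: "jet_smooth F"
  shows "pd c (pd d F) = pd d (pd c F)"
proof (cases "c = d")
  case False
  show ?thesis
  proof
    fix z :: jet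
    define h :: "nat \<Rightarrow> real" where "h n = inverse (real (Suc n))" for n
    have h: "h n > 0" for n by (simp add: h_def)
    have h0: "h \<longlonglongrightarrow> 0" unfolding h_def by (rule LIMSEQ_inverse_real_of_nat)
    have lim: "(\<lambda>n. G (z(c := a n, d := b n))) \<longlonglongrightarrow> G z"
      if G: "jet_smooth G" and ab: "\<And>n. z c < a n \<and> a n < z c + h n \<and> z d < b n \<and> b n < z d + h n" for G a b
    proof -
      have *: "(\<lambda>n. u + h n) \<longlonglongrightarrow> u" for u using tendsto_add[OF tendsto_const h0] by simp
      have "a \<longlonglongrightarrow> z c"
        by (rule tendsto_sandwich[OF _ _ tendsto_const *]) (use ab in \<open>auto intro!: always_eventually less_imp_le\<close>)
      moreover have "b \<longlonglongrightarrow> z d"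
        by (rule tendsto_sandwich[OF _ _ tendsto_const *]) (use ab in \<open>auto intro!: always_eventually less_imp_le\<close>)
      ultimately have "(\<lambda>n. (a n, b n)) \<longlonglongrightarrow> (z c, z d)" by (rule tendsto_Pair)
      from continuous_on_tendsto_compose[OF continuous_on_fun_upd2[OF jet_smooth_continuous[OF G], of z c d] this]
      show ?thesis by simp
    qed
    define Q where "Q n a b \<longleftrightarrow> z c < a \<and> a < z c + h n \<and> z d < b \<and> b < z d + h n" for n a b
    define \<Delta> where "\<Delta> n = F (z(c := z c + h n, d := z d + h n)) - F (z(c := z c, d := z d + h n))
      - F (z(c := z c + h n, d := z d)) + F (z(c := z c, d := z d))" for n
    have twist: "z(d := s, c := r) = z(c := r, d := s)" for r s
      using False by (simp add: fun_upd_twist)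
    have "\<exists>a b. Q n a b \<and> \<Delta> n = (h n)\<^sup>2 * pd d (pd c F) (z(c := a, d := b))" for n
      using second_difference[OF F h False, of "z c" n "z d" z] by (simp add: Q_def \<Delta>_def)
    then obtain a b where ab: "\<And>n. Q n (a n) (b n)"
      and eq1: "\<And>n. \<Delta> n = (h n)\<^sup>2 * pd d (pd c F) (z(c := a n, d := b n))"
      by metis
    have "\<exists>b a. Q n a b \<and> \<Delta> n = (h n)\<^sup>2 * pd c (pd d F) (z(c := a, d := b))" for n
      using second_difference[OF F h False[symmetric], of "z d" n "z c" z]
      unfolding twist Q_def \<Delta>_def by (simp add: algebra_simps) blast
    then obtain b' a' where ab': "\<And>n. Q n (a' n) (b' n)"
      and eq2: "\<And>n. \<Delta> n = (h n)\<^sup>2 * pd c (pd d F) (z(c := a' n, d := b' n))"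
      by metis
    have eq: "pd d (pd c F) (z(c := a n, d := b n)) = pd c (pd d F) (z(c := a' n, d := b' n))" for n
      using eq1[of n] eq2[of n] h[of n] by simp
    have "(\<lambda>n. pd d (pd c F) (z(c := a n, d := b n))) \<longlonglongrightarrow> pd c (pd d F) z"
      unfolding eq by (rule lim[OF jet_smooth_pd[OF jet_smooth_pd[OF F]] ab'[unfolded Q_def]])
    moreover have "(\<lambda>n. pd d (pd c F) (z(c := a n, d := b n))) \<longlonglongrightarrow> pd d (pd c F) z"
      by (rule lim[OF jet_smooth_pd[OF jet_smooth_pd[OF F]] ab[unfolded Q_def]])
    ultimately show "pd c (pd d F) z = pd d (pd c F) z" by (rule LIMSEQ_unique)
  qed
qed simp

lemma depends_on_mono: "depends_on V F \<Longrightarrow> V \<subseteq> V' \<Longrightarrow> depends_on V' F"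
  unfolding depends_on_def by blast

lemma pd_eq_0:
  assumes "depends_on V F" "c \<notin> V"
  shows "pd c F = (\<lambda>z. 0)"
proof
  fix z
  have "F (z(c := s)) = F z" for s
  proof -
    have "\<forall>ca\<in>V. (z(c := s)) ca = z ca" using assms(2) by auto
    then show ?thesis using assms(1) unfolding depends_on_def by blast
  qed
  then show "pd c F z = 0" by (simp add: pd_def)
qed

lemma depends_on_pd:
  assumes "depends_on V F"
  shows "depends_on V (pd c F)"
proof (cases "c \<in> V")
  case True
  show ?thesis unfolding depends_on_def
  proof (intro allI impI)
    fix z z' :: jet
    assume e: "\<forall>c\<in>V. z c = z' c"
    then have "F (z(c := s)) = F (z'(c := s))" for s
      using assms[unfolded depends_on_def, rule_format, of "z(c := s)" "z'(c := s)"] by auto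
    then show "pd c F z = pd c F z'" using e True by (simp add: pd_def)
  qed
next
  case False
  then show ?thesis using pd_eq_0[OF assms] by (simp add: depends_on_def)
qed

lemma depends_on_const [simp]: "depends_on V (\<lambda>z. k)" by (simp add: depends_on_def)
lemma depends_on_coordinate: "c \<in> V \<Longrightarrow> depends_on V (\<lambda>z. z c)" by (simp add: depends_on_def)
lemma depends_on_binop: "depends_on V f \<Longrightarrow> depends_on V g \<Longrightarrow> depends_on V (\<lambda>z. h (f z) (g z))"
  unfolding depends_on_def by (intro allI impI arg_cong2[of _ _ _ _ h]) blast+

text \<open>The index set in the definition varies with \<open>F\<close> and \<open>z\<close>. A
  fixed finite \<open>M\<close> lets the sums of several functions be combined termwise; the
  additional terms are zero.\<close>

lemma total_deriv_eq:
  assumes "depends_on V F" "finite M" "{J. Deriv J \<in> V} \<subseteq> M"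
  shows "total_deriv i F z = pd (Indep i) F z + (\<Sum>J\<in>M. z (Deriv (add_mset i J)) * pd (Deriv J) F z)"
proof -
  have "{J. pd (Deriv J) F z \<noteq> 0} \<subseteq> M"
    using assms(3) pd_eq_0[OF assms(1)] by fastforce
  then show ?thesis unfolding total_deriv_def
    by (intro arg_cong2[of _ _ _ _ "(+)"] refl sum.mono_neutral_left) (use assms(2) in auto)
qed

section \<open>Prolongations\<close>

text \<open>The order of the index type starts with \<open>3 = 0\<close>.\<close>

lemma atLeast_3: "{3::3..} = {1, 2, 3}" "{1::3..} = {1, 2}" "{2::3..} = {2}"
proof -
  have "(1::3) \<le> 2" "\<not> (2::3) \<le> 1" "\<not> (1::3) \<le> 3" "\<not> (2::3) \<le> 3" "(3::3) \<le> 1" "(3::3) \<le> 2"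
    by (simp_all add: less_eq_bit1_def bit1.Rep_1 bit1.Rep_numeral)
  then show "{3::3..} = {1, 2, 3}" "{1::3..} = {1, 2}" "{2::3..} = {2}"
    by (auto simp: set_eq_iff forall_3)
qed

section \<open>Total derivatives as derivations on differential functions\<close>

lemma differential_function_const [simp]: "differential_function (\<lambda>z. k)"
  unfolding differential_function_def by (auto intro: exI[of _ "{}"])

lemma differential_function_coordinate [simp]: "differential_function (\<lambda>z. z c)"
  unfolding differential_function_def by (auto intro!: exI[of _ "{c}"] depends_on_coordinate)

lemma depends_on_common:
  assumes "differential_function f" "differential_function g"
  obtains V where "finite V" "depends_on V f" "depends_on V g"
proof -
  obtain V W where "finite V" "depends_on V f" "finite W" "depends_on W g"
    using assms unfolding differential_function_def by blast
  then show ?thesis by (intro that[of "V \<union> W"]) (auto elim: depends_on_mono)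
qed

lemma differential_function_smooth [simp]: "differential_function f \<Longrightarrow> jet_smooth f"
  by (simp add: differential_function_def)

lemma differential_function_add [simp]:
  assumes "differential_function f" "differential_function g"
  shows "differential_function (\<lambda>z. f z + g z)"
proof -
  obtain V where "finite V" "depends_on V f" "depends_on V g" using depends_on_common[OF assms] .
  then show ?thesis
    using assms depends_on_binop[of V f g "(+)"] unfolding differential_function_def by auto
qed

lemma differential_function_mult [simp]:
  assumes "differential_function f" "differential_function g"
  shows "differential_function (\<lambda>z. f z * g z)"
proof -
  obtain V where "finite V" "depends_on V f" "depends_on V g" using depends_on_common[OF assms] .
  then show ?thesis
    using assms depends_on_binop[of V f g "(*)"] unfolding differential_function_def by auto
qed

lemma differential_function_minus [simp]:
  "differential_function f \<Longrightarrow> differential_function (\<lambda>z. - f z)"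
  using differential_function_mult[of "\<lambda>_. -1" f] by simp

lemma differential_function_diff [simp]:
  "differential_function f \<Longrightarrow> differential_function g \<Longrightarrow> differential_function (\<lambda>z. f z - g z)"
  using differential_function_add[of f "\<lambda>z. - g z"] by simp

lemma differential_function_sum [simp]:
  "(\<And>i. i \<in> I \<Longrightarrow> differential_function (f i)) \<Longrightarrow> differential_function (\<lambda>z. \<Sum>i\<in>I. f i z)"
  by (induction I rule: infinite_finite_induct) auto

lemma finite_Deriv_indices: "finite V \<Longrightarrow> finite {J. Deriv J \<in> V}"
  using finite_vimageI[of V Deriv] by (simp add: vimage_def inj_on_def)

lemma total_deriv_const [simp]: "total_deriv i (\<lambda>z. k) = (\<lambda>z. 0)"
  by (simp add: total_deriv_def fun_eq_iff)

lemma total_deriv_coordinate [simp]: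
  "total_deriv i (\<lambda>z. z (Indep j)) = (\<lambda>z. if i = j then 1 else 0)"
  "total_deriv i (\<lambda>z. z (Deriv J)) = (\<lambda>z. z (Deriv (add_mset i J)))"
  by (simp_all add: total_deriv_def total_deriv_Deriv fun_eq_iff)

lemma total_deriv_add [simp]:
  assumes "differential_function f" "differential_function g"
  shows "total_deriv i (\<lambda>z. f z + g z) = (\<lambda>z. total_deriv i f z + total_deriv i g z)"
proof -
  obtain V where V: "finite V" "depends_on V f" "depends_on V g" using depends_on_common[OF assms] .
  note * = total_deriv_eq[OF _ finite_Deriv_indices[OF V(1)] subset_refl]
  show ?thesis
    by (simp add: fun_eq_iff *[OF V(2)] *[OF V(3)] *[OF depends_on_binop[OF V(2,3), of "(+)"]]
        assms algebra_simps sum.distrib)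
qed

lemma total_deriv_mult [simp]:
  assumes "differential_function f" "differential_function g"
  shows "total_deriv i (\<lambda>z. f z * g z) = (\<lambda>z. total_deriv i f z * g z + f z * total_deriv i g z)"
proof -
  obtain V where V: "finite V" "depends_on V f" "depends_on V g" using depends_on_common[OF assms] .
  note * = total_deriv_eq[OF _ finite_Deriv_indices[OF V(1)] subset_refl]
  show ?thesis
    by (simp add: fun_eq_iff *[OF V(2)] *[OF V(3)] *[OF depends_on_binop[OF V(2,3), of "(*)"]]
        assms algebra_simps sum.distrib sum_distrib_left sum_distrib_right)
qed

lemma total_deriv_minus [simp]:
  "differential_function f \<Longrightarrow> total_deriv i (\<lambda>z. - f z) = (\<lambda>z. - total_deriv i f z)"
  using total_deriv_mult[of "\<lambda>_. -1" f i] by simp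

lemma total_deriv_diff [simp]:
  "differential_function f \<Longrightarrow> differential_function g \<Longrightarrow>
    total_deriv i (\<lambda>z. f z - g z) = (\<lambda>z. total_deriv i f z - total_deriv i g z)"
  using total_deriv_add[of f "\<lambda>z. - g z" i] by simp

lemma total_deriv_sum [simp]:
  "(\<And>k. k \<in> I \<Longrightarrow> differential_function (f k)) \<Longrightarrow>
    total_deriv i (\<lambda>z. \<Sum>k\<in>I. f k z) = (\<lambda>z. \<Sum>k\<in>I. total_deriv i (f k) z)"
  by (induction I rule: infinite_finite_induct) auto

lemma point_function_differential [simp]: "point_function f \<Longrightarrow> differential_function f"
  unfolding point_function_def differential_function_def by (auto intro!: exI[of _ "insert (Deriv {#}) (range Indep)"])

lemma point_function_smooth: "point_function f \<Longrightarrow> jet_smooth f"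
  by (simp add: point_function_def)

lemma point_function_pd [simp]: "point_function f \<Longrightarrow> point_function (pd c f)"
  by (simp add: point_function_def depends_on_pd)

lemma base_function_point [simp]: "base_function f \<Longrightarrow> point_function f"
  unfolding point_function_def base_function_def by (auto elim: depends_on_mono)

lemma base_function_smooth: "base_function f \<Longrightarrow> jet_smooth f"
  by (simp add: base_function_def)

lemma base_function_pd [simp]: "base_function f \<Longrightarrow> base_function (pd c f)"
  by (simp add: base_function_def depends_on_pd)

lemma base_function_pd_Deriv [simp]: "base_function f \<Longrightarrow> pd (Deriv J) f = (\<lambda>z. 0)"
  unfolding base_function_def by (rule pd_eq_0) auto

lemma total_deriv_point:
  assumes "point_function f"
  shows "total_deriv i f = (\<lambda>z. pd (Indep i) f z + z (Deriv {#i#}) * pd (Deriv {#}) f z)"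
proof
  fix z
  show "total_deriv i f z = pd (Indep i) f z + z (Deriv {#i#}) * pd (Deriv {#}) f z"
    using total_deriv_eq[of "insert (Deriv {#}) (range Indep)" f "{{#}}" i z] assms
    by (auto simp: point_function_def)
qed

lemma total_deriv_base: "base_function f \<Longrightarrow> total_deriv i f = pd (Indep i) f"
  by (simp add: total_deriv_point)

text \<open>The second total derivative of a function of (x, y, t, u), expanded so that its
  dependence on the derivatives of u is polynomial and visible.\<close>

definition point_deriv2 :: "3 \<Rightarrow> 3 \<Rightarrow> (jet \<Rightarrow> real) \<Rightarrow> jet \<Rightarrow> real" where
  "point_deriv2 i j f z = pd (Indep i) (pd (Indep j) f) z
    + z (Deriv {#i#}) * pd (Indep j) (pd (Deriv {#}) f) z
    + z (Deriv {#j#}) * pd (Indep i) (pd (Deriv {#}) f) z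
    + z (Deriv {#i#}) * z (Deriv {#j#}) * pd (Deriv {#}) (pd (Deriv {#}) f) z
    + z (Deriv {#i, j#}) * pd (Deriv {#}) f z"

lemma total_deriv2_point:
  assumes "point_function f"
  shows "total_deriv j (total_deriv i f) = point_deriv2 i j f"
  using pd_commute[of f "Deriv {#}" "Indep i"] pd_commute[of f "Deriv {#}" "Indep j"] pd_commute[of f "Indep j" "Indep i"] assms
  by (simp add: point_deriv2_def total_deriv_point fun_eq_iff algebra_simps add_mset_commute
      point_function_smooth)

lemma eta2_point:
  assumes "point_vector_field S"
  shows "eta2 S i j z = point_deriv2 i j (eta S) z - (\<Sum>k\<in>UNIV. point_deriv2 i j (xi S k) z * z (Deriv {#k#})
    + total_deriv i (xi S k) z * z (Deriv {#j, k#}) + total_deriv j (xi S k) z * z (Deriv {#i, k#}))"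
proof -
  have p: "point_function (xi S k)" "point_function (eta S)" for k
    using assms by (simp_all add: point_vector_field_def)
  have d: "differential_function (total_deriv i f)" if "point_function f" for f i
    using that by (simp add: total_deriv_point)
  show ?thesis
    unfolding eta2_def eta1_def[abs_def]
    by (simp add: p d total_deriv2_point sum.distrib sum_subtractf add_mset_commute)
qed

lemma heisenberg_eq_fun: "heisenberg_eq = (\<lambda>z. z (Deriv {#1, 1#}) + z (Deriv {#2, 2#}) + 4 * ((xc z)\<^sup>2 + (yc z)\<^sup>2) * z (Deriv {#3, 3#})
     + 4 * yc z * z (Deriv {#1, 3#}) - 4 * xc z * z (Deriv {#2, 3#}) + uc z)"
  by (rule ext) (rule heisenberg_eq_explicit)

text \<open>The order on the index type puts 3 before 1 and 2, so \<open>pr2\<close> yields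
  \<open>eta2 S 3 1\<close> and \<open>eta2 S 3 2\<close>; these have to be turned into the usual 1
  3 and 2 3.\<close>

lemma eta2_commute: "point_vector_field S \<Longrightarrow> eta2 S i j = eta2 S j i"
  by (rule ext)
    (simp add: eta2_point point_deriv2_def pd_commute[of _ "Indep j" "Indep i"] point_vector_field_def
      point_function_smooth add_mset_commute algebra_simps sum.distrib)

lemma mset_pair_eq_iff: "{#a, b#} = {#c, d#} \<longleftrightarrow> a = c \<and> b = d \<or> a = d \<and> b = c"
  by (auto simp: add_mset_eq_singleton_iff add_eq_conv_ex)

lemma pr2_heisenberg:
  assumes "point_vector_field S"
  shows "pr2 S heisenberg_eq z = 
    xi S 1 z * (8 * xc z * z (Deriv {#3, 3#}) - 4 * z (Deriv {#2, 3#}))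
    + xi S 2 z * (8 * yc z * z (Deriv {#3, 3#}) + 4 * z (Deriv {#1, 3#})) + eta S z
    + eta2 S 1 1 z + eta2 S 2 2 z + 4 * ((xc z)\<^sup>2 + (yc z)\<^sup>2) * eta2 S 3 3 z
    + 4 * yc z * eta2 S 1 3 z - 4 * xc z * eta2 S 2 3 z"
  unfolding pr2_def pr1_def vf_apply_def heisenberg_eq_fun
  by (simp add: sum_3 atLeast_3 mset_pair_eq_iff eta2_commute[OF assms, of 3 1] eta2_commute[OF assms, of 3 2] algebra_simps)

section \<open>Determining equations\<close>

text \<open>The frame \<open>X = \<partial>\<^sub>x + 2 y \<partial>\<^sub>t\<close>, \<open>Y = \<partial>\<^sub>y - 2 x \<partial>\<^sub>t\<close>; written in it, \<open>\<Delta>\<close> has no lower-order terms.\<close>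

definition HX :: "(jet \<Rightarrow> real) \<Rightarrow> jet \<Rightarrow> real" where
  "HX f z = pd (Indep 1) f z + 2 * yc z * pd (Indep 3) f z"

definition HY :: "(jet \<Rightarrow> real) \<Rightarrow> jet \<Rightarrow> real" where
  "HY f z = pd (Indep 2) f z - 2 * xc z * pd (Indep 3) f z"

definition sublaplacian :: "(jet \<Rightarrow> real) \<Rightarrow> jet \<Rightarrow> real" where
  "sublaplacian f z = HX (HX f) z + HY (HY f) z"

lemma HX_smooth [simp]: "jet_smooth f \<Longrightarrow> jet_smooth (HX f)"
  unfolding HX_def[abs_def] by simp

lemma HY_smooth [simp]: "jet_smooth f \<Longrightarrow> jet_smooth (HY f)"
  unfolding HY_def[abs_def] by simp

lemma sublaplacian_explicit:
  assumes "jet_smooth f"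
  shows "sublaplacian f z = pd (Indep 1) (pd (Indep 1) f) z + pd (Indep 2) (pd (Indep 2) f) z
    + 4 * ((xc z)\<^sup>2 + (yc z)\<^sup>2) * pd (Indep 3) (pd (Indep 3) f) z
    + 4 * yc z * pd (Indep 1) (pd (Indep 3) f) z - 4 * xc z * pd (Indep 2) (pd (Indep 3) f) z"
  using assms pd_commute[OF assms, of "Indep 3" "Indep 1"] pd_commute[OF assms, of "Indep 3" "Indep 2"]
  by (simp add: sublaplacian_def HX_def[abs_def] HY_def[abs_def] algebra_simps power2_eq_square)

lemma kohn_laplace_base:
  assumes "base_function f"
  shows "kohn_laplace f z = sublaplacian f z"
  using assms pd_commute[of f "Indep 3" "Indep 1"] pd_commute[of f "Indep 3" "Indep 2"]
  by (simp add: kohn_laplace_def total_deriv_base sublaplacian_explicit base_function_smooth)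

text \<open>A jet with freely chosen first and second derivatives over the base values of
  \<open>z0\<close>. Point functions do not notice the change, so a symmetry condition becomes
  polynomial in the nine parameters.\<close>

definition jet2 where
  "jet2 z0 p1 p2 p3 q11 q12 q13 q22 q23 q33 = (\<lambda>c :: jet_coord. 
    if c = Deriv {#1#} then p1 else if c = Deriv {#2#} then p2 else if c = Deriv {#3#} then p3
    else if c = Deriv {#1, 1#} then q11 else if c = Deriv {#1, 2#} then q12
    else if c = Deriv {#1, 3#} then q13 else if c = Deriv {#2, 2#} then q22
    else if c = Deriv {#2, 3#} then q23 else if c = Deriv {#3, 3#} then q33 else z0 c :: real)"

lemma jet2_simps [simp]:
  "jet2 z0 p1 p2 p3 q11 q12 q13 q22 q23 q33 (Indep i) = z0 (Indep i)"
  "jet2 z0 p1 p2 p3 q11 q12 q13 q22 q23 q33 (Deriv {#}) = z0 (Deriv {#})"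
  "jet2 z0 p1 p2 p3 q11 q12 q13 q22 q23 q33 (Deriv {#1#}) = p1"
  "jet2 z0 p1 p2 p3 q11 q12 q13 q22 q23 q33 (Deriv {#2#}) = p2"
  "jet2 z0 p1 p2 p3 q11 q12 q13 q22 q23 q33 (Deriv {#3#}) = p3"
  "jet2 z0 p1 p2 p3 q11 q12 q13 q22 q23 q33 (Deriv {#1, 1#}) = q11"
  "jet2 z0 p1 p2 p3 q11 q12 q13 q22 q23 q33 (Deriv {#1, 2#}) = q12"
  "jet2 z0 p1 p2 p3 q11 q12 q13 q22 q23 q33 (Deriv {#2, 1#}) = q12"
  "jet2 z0 p1 p2 p3 q11 q12 q13 q22 q23 q33 (Deriv {#1, 3#}) = q13"
  "jet2 z0 p1 p2 p3 q11 q12 q13 q22 q23 q33 (Deriv {#3, 1#}) = q13"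
  "jet2 z0 p1 p2 p3 q11 q12 q13 q22 q23 q33 (Deriv {#2, 2#}) = q22"
  "jet2 z0 p1 p2 p3 q11 q12 q13 q22 q23 q33 (Deriv {#2, 3#}) = q23"
  "jet2 z0 p1 p2 p3 q11 q12 q13 q22 q23 q33 (Deriv {#3, 2#}) = q23"
  "jet2 z0 p1 p2 p3 q11 q12 q13 q22 q23 q33 (Deriv {#3, 3#}) = q33"
  by (simp_all add: jet2_def mset_pair_eq_iff)

lemma point_function_jet2:
  assumes "point_function f"
  shows "f (jet2 z0 p1 p2 p3 q11 q12 q13 q22 q23 q33) = f z0"
proof -
  have "depends_on (insert (Deriv {#}) (range Indep)) f" using assms by (simp add: point_function_def)
  then show ?thesis unfolding depends_on_def
    by (elim allE[of _ "jet2 z0 p1 p2 p3 q11 q12 q13 q22 q23 q33"] allE[of _ z0]) auto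
qed

text \<open>\<open>P1\<close>, \<open>P2\<close> and \<open>K\<close> are X u, Y u and Delta u on
  the jet. The bracketed sums are Delta of a function of (x, y, t, u) by the chain rule. The last
  three lines are the cross terms, pairing the X and Y total derivatives of \<xi> with those of u_x,
  u_y, u_t. The terms in front come from differentiating the coefficients of Delta and the term
  u.\<close>

lemma pr2_jet2:
  assumes S: "point_vector_field S"
  defines "a \<equiv> xi S 1" and "b \<equiv> xi S 2" and "c \<equiv> xi S 3" and "h \<equiv> eta S"
  defines "U \<equiv> pd (Deriv {#})"
  assumes K: "K = q11 + q22 + 4 * ((xc z)\<^sup>2 + (yc z)\<^sup>2) * q33 + 4 * yc z * q13 - 4 * xc z * q23"
    and P: "P1 = p1 + 2 * yc z * p3" "P2 = p2 - 2 * xc z * p3"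
  shows "pr2 S heisenberg_eq (jet2 z p1 p2 p3 q11 q12 q13 q22 q23 q33) =
    a z * (8 * xc z * q33 - 4 * q23) + b z * (8 * yc z * q33 + 4 * q13) + h z
    + (sublaplacian h z + 2 * (HX (U h) z * P1 + HY (U h) z * P2) + U (U h) z * (P1\<^sup>2 + P2\<^sup>2) + U h z * K)
    - p1 * (sublaplacian a z + 2 * (HX (U a) z * P1 + HY (U a) z * P2) + U (U a) z * (P1\<^sup>2 + P2\<^sup>2) + U a z * K)
    - p2 * (sublaplacian b z + 2 * (HX (U b) z * P1 + HY (U b) z * P2) + U (U b) z * (P1\<^sup>2 + P2\<^sup>2) + U b z * K)
    - p3 * (sublaplacian c z + 2 * (HX (U c) z * P1 + HY (U c) z * P2) + U (U c) z * (P1\<^sup>2 + P2\<^sup>2) + U c z * K)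
    - 2 * ((HX a z + U a z * P1) * (q11 + 2 * yc z * q13) + (HY a z + U a z * P2) * (q12 - 2 * xc z * q13)
         + (HX b z + U b z * P1) * (q12 + 2 * yc z * q23) + (HY b z + U b z * P2) * (q22 - 2 * xc z * q23)
         + (HX c z + U c z * P1) * (q13 + 2 * yc z * q33) + (HY c z + U c z * P2) * (q23 - 2 * xc z * q33))"
proof -
  have p: "point_function (xi S k)" "point_function (eta S)" for k
    using S by (simp_all add: point_vector_field_def)
  note q = p[THEN point_function_pd] p[THEN point_function_pd, THEN point_function_pd]
  show ?thesis
    unfolding assms(2-6) K P pr2_heisenberg[OF S] eta2_point[OF S] sum_3
    by (simp add: p point_function_smooth sublaplacian_explicit HX_def HY_def total_deriv_point
      point_deriv2_def p[THEN point_function_jet2] q[THEN point_function_jet2]) algebra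
qed

section \<open>Calculus in the frame X, Y\<close>

lemma HX_simps [simp]:
  "HX (\<lambda>z. k) = (\<lambda>z. 0)"
  "HX (\<lambda>z. xc z) = (\<lambda>z. 1)"
  "HX (\<lambda>z. yc z) = (\<lambda>z. 0)"
  "jet_smooth f \<Longrightarrow> HX (\<lambda>z. - f z) = (\<lambda>z. - HX f z)"
  "jet_smooth f \<Longrightarrow> jet_smooth g \<Longrightarrow> HX (\<lambda>z. f z + g z) = (\<lambda>z. HX f z + HX g z)"
  "jet_smooth f \<Longrightarrow> jet_smooth g \<Longrightarrow> HX (\<lambda>z. f z - g z) = (\<lambda>z. HX f z - HX g z)"
  "jet_smooth f \<Longrightarrow> jet_smooth g \<Longrightarrow> HX (\<lambda>z. f z * g z) = (\<lambda>z. HX f z * g z + f z * HX g z)"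
  by (simp_all add: HX_def fun_eq_iff algebra_simps)

lemma HY_simps [simp]:
  "HY (\<lambda>z. k) = (\<lambda>z. 0)"
  "HY (\<lambda>z. xc z) = (\<lambda>z. 0)"
  "HY (\<lambda>z. yc z) = (\<lambda>z. 1)"
  "jet_smooth f \<Longrightarrow> HY (\<lambda>z. - f z) = (\<lambda>z. - HY f z)"
  "jet_smooth f \<Longrightarrow> jet_smooth g \<Longrightarrow> HY (\<lambda>z. f z + g z) = (\<lambda>z. HY f z + HY g z)"
  "jet_smooth f \<Longrightarrow> jet_smooth g \<Longrightarrow> HY (\<lambda>z. f z - g z) = (\<lambda>z. HY f z - HY g z)"
  "jet_smooth f \<Longrightarrow> jet_smooth g \<Longrightarrow> HY (\<lambda>z. f z * g z) = (\<lambda>z. HY f z * g z + f z * HY g z)"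
  by (simp_all add: HY_def fun_eq_iff algebra_simps)

lemma HX_HY_commutator:
  assumes "jet_smooth f"
  shows "HY (HX f) = (\<lambda>z. HX (HY f) z + 4 * pd (Indep 3) f z)"
  using assms pd_commute[OF assms, of "Indep 3" "Indep 1"] pd_commute[OF assms, of "Indep 3" "Indep 2"]
    pd_commute[OF assms, of "Indep 2" "Indep 1"]
  by (simp add: HX_def[abs_def] HY_def[abs_def] algebra_simps fun_eq_iff)

lemma HX_pd3: "jet_smooth f \<Longrightarrow> HX (pd (Indep 3) f) = pd (Indep 3) (HX f)"
  using pd_commute[of f "Indep 3" "Indep 1"]
  by (simp add: HX_def[abs_def] algebra_simps fun_eq_iff)

lemma HY_pd3: "jet_smooth f \<Longrightarrow> HY (pd (Indep 3) f) = pd (Indep 3) (HY f)"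
  using pd_commute[of f "Indep 3" "Indep 2"]
  by (simp add: HY_def[abs_def] algebra_simps fun_eq_iff)

lemma pd_eq_0_imp_upd:
  assumes "jet_smooth f" "pd c f = (\<lambda>z. 0)"
  shows "f (z(c := s)) = f z"
proof -
  have "f (z(c := s)) = f (z(c := z c))"
    by (rule DERIV_isconst_all[of "\<lambda>s. f (z(c := s))"]) (use jet_smooth_DERIV[OF assms(1), of z c] assms(2) in simp)
  then show ?thesis by simp
qed

lemma point_function_pd_u_0:
  assumes f: "point_function f" and 0: "pd (Deriv {#}) f = (\<lambda>z. 0)"
  shows "base_function f"
  unfolding base_function_def depends_on_def
proof (intro conjI allI impI)
  show "jet_smooth f" using f by (simp add: point_function_smooth)
  fix z z' :: jet assume e: "\<forall>c\<in>range Indep. z c = z' c"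
  have "f (z(Deriv {#} := z' (Deriv {#}))) = f z'"
  proof (rule f[unfolded point_function_def depends_on_def, THEN conjunct2, rule_format])
    fix c assume "c \<in> insert (Deriv {#}) (range Indep)"
    then show "(z(Deriv {#} := z' (Deriv {#}))) c = z' c" using e by auto
  qed
  then show "f z = f z'" using pd_eq_0_imp_upd[OF point_function_smooth[OF f] 0] by simp
qed

lemma base_function_constant:
  assumes f: "base_function f" and 0: "\<And>i. pd (Indep i) f = (\<lambda>z. 0)"
  obtains k where "f = (\<lambda>z. k)"
proof
  show "f = (\<lambda>z. f (\<lambda>_. 0))"
  proof
    fix z
    have "f z = f (z(Indep 1 := 0, Indep 2 := 0, Indep 3 := 0))"
      using pd_eq_0_imp_upd[OF base_function_smooth[OF f] 0] by simp
    also have "\<dots> = f (\<lambda>_. 0)"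
    proof (rule f[unfolded base_function_def depends_on_def, THEN conjunct2, rule_format])
      fix c assume "c \<in> range Indep"
      then obtain i where "c = Indep i" by blast
      then show "(z(Indep 1 := 0, Indep 2 := 0, Indep 3 := 0)) c = 0" using exhaust_3[of i] by auto
    qed
    finally show "f z = f (\<lambda>_. 0)" .
  qed
qed

text \<open>X and Y are bracket generating: their commutator is a multiple of d/dt, so the t
  derivative vanishes too, and then the x and y derivatives.\<close>

lemma base_function_frame_constant:
  assumes f: "base_function f" and 0: "HX f = (\<lambda>z. 0)" "HY f = (\<lambda>z. 0)"
  obtains k where "f = (\<lambda>z. k)"
proof -
  have t: "pd (Indep 3) f = (\<lambda>z. 0)"
    using HX_HY_commutator[OF base_function_smooth[OF f]] 0 by (simp add: fun_eq_iff)
  moreover have "pd (Indep 1) f = (\<lambda>z. 0)" "pd (Indep 2) f = (\<lambda>z. 0)"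
    using 0 t by (simp_all add: HX_def HY_def fun_eq_iff)
  ultimately have "pd (Indep i) f = (\<lambda>z. 0)" for i using exhaust_3[of i] by auto
  with base_function_constant[OF f] that show thesis by blast
qed

lemma base_function_add: "base_function f \<Longrightarrow> base_function g \<Longrightarrow> base_function (\<lambda>z. f z + g z)"
  by (simp add: base_function_def depends_on_binop[of _ _ _ "(+)"])

lemma base_function_mult: "base_function f \<Longrightarrow> base_function g \<Longrightarrow> base_function (\<lambda>z. f z * g z)"
  by (simp add: base_function_def depends_on_binop[of _ _ _ "(*)"])

lemma base_function_const: "base_function (\<lambda>z. k)"
  by (simp add: base_function_def)

lemma base_function_coordinate: "base_function (\<lambda>z. z (Indep i))"
  by (simp add: base_function_def depends_on_coordinate)

lemma base_function_diff: "base_function f \<Longrightarrow> base_function g \<Longrightarrow> base_function (\<lambda>z. f z - g z)"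
  by (simp add: base_function_def depends_on_binop[of _ _ _ "(-)"])

lemmas base_function_intros = base_function_add base_function_mult base_function_const base_function_coordinate base_function_diff

lemma base_function_HX [simp]: "base_function f \<Longrightarrow> base_function (HX f)"
  unfolding HX_def[abs_def] by (intro base_function_intros) auto

lemma base_function_HY [simp]: "base_function f \<Longrightarrow> base_function (HY f)"
  unfolding HY_def[abs_def] by (intro base_function_intros) auto

text \<open>Solving the equation for u_xx leaves the other derivatives independent, so every
  coefficient of the resulting polynomial in them vanishes. The identities in X and Y are these
  coefficients.\<close>

lemma lie_point_symmetry_components:
  assumes "lie_point_symmetry heisenberg_eq S"
  obtains a b c \<alpha> \<beta> where
    "xi S 1 = a" "xi S 2 = b" "xi S 3 = c" "eta S = (\<lambda>z. \<alpha> z * uc z + \<beta> z)"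
    "base_function a" "base_function b" "base_function c" "base_function \<alpha>" "base_function \<beta>"
    "\<And>z. HY b z = HX a z" "\<And>z. HX b z = - HY a z"
    "\<And>z. HX c z = 2 * b z + 2 * yc z * HX a z + 2 * xc z * HY a z"
    "\<And>z. HY c z = - 2 * a z - 2 * xc z * HX a z + 2 * yc z * HY a z"
    "\<And>z. 2 * HX \<alpha> z = sublaplacian a z" "\<And>z. 2 * HY \<alpha> z = sublaplacian b z"
    "\<And>z. sublaplacian \<alpha> z = - 2 * HX a z" "\<And>z. sublaplacian \<beta> z + \<beta> z = 0"
proof -
  have S: "point_vector_field S" and sym: "\<And>z. heisenberg_eq z = 0 \<Longrightarrow> pr2 S heisenberg_eq z = 0"
    using assms by (auto simp: lie_point_symmetry_def)
  define a b c h U where defs: "a = xi S 1" "b = xi S 2" "c = xi S 3" "h = eta S" "U = pd (Deriv {#})"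
  have p: "point_function a" "point_function b" "point_function c" "point_function h"
    using S by (simp_all add: point_vector_field_def defs)
  have E: "a z * (8 * xc z * q33 - 4 * q23) + b z * (8 * yc z * q33 + 4 * q13) + h z
    + (sublaplacian h z + 2 * (HX (U h) z * (p1 + 2 * yc z * p3) + HY (U h) z * (p2 - 2 * xc z * p3)) + U (U h) z * ((p1 + 2 * yc z * p3)\<^sup>2 + (p2 - 2 * xc z * p3)\<^sup>2) - U h z * uc z)
    - p1 * (sublaplacian a z + 2 * (HX (U a) z * (p1 + 2 * yc z * p3) + HY (U a) z * (p2 - 2 * xc z * p3)) + U (U a) z * ((p1 + 2 * yc z * p3)\<^sup>2 + (p2 - 2 * xc z * p3)\<^sup>2) - U a z * uc z)
    - p2 * (sublaplacian b z + 2 * (HX (U b) z * (p1 + 2 * yc z * p3) + HY (U b) z * (p2 - 2 * xc z * p3)) + U (U b) z * ((p1 + 2 * yc z * p3)\<^sup>2 + (p2 - 2 * xc z * p3)\<^sup>2) - U b z * uc z)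
    - p3 * (sublaplacian c z + 2 * (HX (U c) z * (p1 + 2 * yc z * p3) + HY (U c) z * (p2 - 2 * xc z * p3)) + U (U c) z * ((p1 + 2 * yc z * p3)\<^sup>2 + (p2 - 2 * xc z * p3)\<^sup>2) - U c z * uc z)
    - 2 * ((HX a z + U a z * (p1 + 2 * yc z * p3)) * (- uc z - q22 - 4 * ((xc z)\<^sup>2 + (yc z)\<^sup>2) * q33 - 2 * yc z * q13 + 4 * xc z * q23) + (HY a z + U a z * (p2 - 2 * xc z * p3)) * (q12 - 2 * xc z * q13)
         + (HX b z + U b z * (p1 + 2 * yc z * p3)) * (q12 + 2 * yc z * q23) + (HY b z + U b z * (p2 - 2 * xc z * p3)) * (q22 - 2 * xc z * q23)
         + (HX c z + U c z * (p1 + 2 * yc z * p3)) * (q13 + 2 * yc z * q33) + (HY c z + U c z * (p2 - 2 * xc z * p3)) * (q23 - 2 * xc z * q33)) = 0"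
    for z p1 p2 p3 q12 q13 q22 q23 q33
  proof -
    \<comment> \<open>This choice puts the jet on the equation, where Delta u equals - u.\<close>
    define q11 where "q11 = - uc z - q22 - 4 * ((xc z)\<^sup>2 + (yc z)\<^sup>2) * q33 - 4 * yc z * q13 + 4 * xc z * q23"
    have "heisenberg_eq (jet2 z p1 p2 p3 q11 q12 q13 q22 q23 q33) = 0"
      by (simp add: heisenberg_eq_explicit q11_def)
    from sym[OF this] have *: "pr2 S heisenberg_eq (jet2 z p1 p2 p3 q11 q12 q13 q22 q23 q33) = 0" .
    have K: "- uc z = q11 + q22 + 4 * ((xc z)\<^sup>2 + (yc z)\<^sup>2) * q33 + 4 * yc z * q13 - 4 * xc z * q23"
      by (simp add: q11_def)
    have q: "q11 + 2 * yc z * q13 = - uc z - q22 - 4 * ((xc z)\<^sup>2 + (yc z)\<^sup>2) * q33 - 2 * yc z * q13 + 4 * xc z * q23"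
      by (simp add: q11_def)
    show ?thesis
      using *[unfolded pr2_jet2[OF S K refl refl], folded defs, unfolded q] by simp
  qed
  \<comment> \<open>The products of u_x with u_yy, u_xy and u_xt carry the u-derivatives of \<xi>. A
    second difference in the two factors isolates each coefficient; the third needs the
    first.\<close>
  have u0: "U a z = 0" "U b z = 0" "U c z = 0" for z
  proof -
    note e = E[of z 0 0 0 0 0 0 0 0, simplified] E[of z 0 0 0 1 0 0 0 0, simplified]
    show "U a z = 0"
      using e E[of z 0 0 0 0 0 0 1 0, simplified] E[of z 0 0 0 1 0 0 1 0, simplified]
      by (simp add: algebra_simps)
    show "U b z = 0"
      using e E[of z 0 0 0 0 0 0 0 1, simplified] E[of z 0 0 0 1 0 0 0 1, simplified]
      by (simp add: algebra_simps)
    show "U c z = 0"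
      using e E[of z 0 0 1 0 0 0 0 0, simplified] E[of z 0 0 1 1 0 0 0 0, simplified] \<open>U a z = 0\<close>
      by (simp add: algebra_simps)
  qed
  then have U0: "U a = (\<lambda>z. 0)" "U b = (\<lambda>z. 0)" "U c = (\<lambda>z. 0)" by auto
  then have base: "base_function a" "base_function b" "base_function c"
    using p by (auto intro: point_function_pd_u_0 simp: defs(5))
  have U00: "U (\<lambda>z. 0) = (\<lambda>z. 0)" by (simp add: defs(5))
  note E2 = E[unfolded U0 U00 HX_simps(1) HY_simps(1), simplified]
  \<comment> \<open>The second difference in u_x isolates the coefficient of u_x^2, so
    \<open>h\<close> is affine in u.\<close>
  have UUh: "U (U h) z = 0" for z
    using E2[where z = z and ?p1.0 = 1 and ?p2.0 = 0 and ?p3.0 = 0 and ?q12.0 = 0 and ?q13.0 = 0 and ?q22.0 = 0 and ?q23.0 = 0 and ?q33.0 = 0]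
      E2[where z = z and ?p1.0 = "-1" and ?p2.0 = 0 and ?p3.0 = 0 and ?q12.0 = 0 and ?q13.0 = 0 and ?q22.0 = 0 and ?q23.0 = 0 and ?q33.0 = 0]
      E2[where z = z and ?p1.0 = 0 and ?p2.0 = 0 and ?p3.0 = 0 and ?q12.0 = 0 and ?q13.0 = 0 and ?q22.0 = 0 and ?q23.0 = 0 and ?q33.0 = 0]
    by simp
  define \<alpha> where "\<alpha> = U h"
  define \<beta> where "\<beta> = (\<lambda>z. h z - \<alpha> z * uc z)"
  have p\<alpha>: "point_function \<alpha>" using p by (simp add: \<alpha>_def defs(5))
  have \<alpha>: "base_function \<alpha>"
    by (rule point_function_pd_u_0[OF p\<alpha>]) (use UUh in \<open>auto simp: \<alpha>_def defs(5)\<close>)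
  have "point_function \<beta>"
    using depends_on_binop[of "insert (Deriv {#}) (range Indep)" \<alpha> uc "(*)"] p(4) p\<alpha>
      depends_on_binop[of "insert (Deriv {#}) (range Indep)" h "\<lambda>z. \<alpha> z * uc z" "(-)"]
    by (simp add: \<beta>_def point_function_def depends_on_coordinate)
  then have \<beta>: "base_function \<beta>"
    by (rule point_function_pd_u_0)
      (use UUh p(4) p\<alpha> in \<open>auto simp: \<beta>_def \<alpha>_def defs(5) fun_eq_iff point_function_smooth\<close>)
  have h: "h = (\<lambda>z. \<alpha> z * uc z + \<beta> z)" by (simp add: \<beta>_def)
  note E3 = E2[unfolded UUh, folded \<alpha>_def, simplified]
  have eqs: "HY b z = HX a z" "HX b z = - HY a z"
    "HX c z = 2 * b z + 2 * yc z * HX a z + 2 * xc z * HY a z"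
    "HY c z = - 2 * a z - 2 * xc z * HX a z + 2 * yc z * HY a z"
    "2 * HX \<alpha> z = sublaplacian a z" "2 * HY \<alpha> z = sublaplacian b z"
    "h z + sublaplacian h z - \<alpha> z * uc z + 2 * uc z * HX a z = 0" for z
  proof -
    \<comment> \<open>The condition is now affine in the free derivatives. \<open>e0\<close> is its
      constant term, and subtracting it from the value at a unit jet gives one linear
      coefficient.\<close>
    note e0 = E3[where z = z and ?p1.0 = 0 and ?p2.0 = 0 and ?p3.0 = 0 and ?q12.0 = 0 and ?q13.0 = 0 and ?q22.0 = 0 and ?q23.0 = 0 and ?q33.0 = 0, simplified]
    show e00: "h z + sublaplacian h z - \<alpha> z * uc z + 2 * uc z * HX a z = 0"
      using e0 by (simp add: algebra_simps)
    show "2 * HX \<alpha> z = sublaplacian a z"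
      using e0 E3[where z = z and ?p1.0 = 1 and ?p2.0 = 0 and ?p3.0 = 0 and ?q12.0 = 0 and ?q13.0 = 0 and ?q22.0 = 0 and ?q23.0 = 0 and ?q33.0 = 0, simplified]
      by linarith
    show "2 * HY \<alpha> z = sublaplacian b z"
      using e0 E3[where z = z and ?p1.0 = 0 and ?p2.0 = 1 and ?p3.0 = 0 and ?q12.0 = 0 and ?q13.0 = 0 and ?q22.0 = 0 and ?q23.0 = 0 and ?q33.0 = 0, simplified]
      by linarith
    show 1: "HY b z = HX a z"
      using e0 E3[where z = z and ?p1.0 = 0 and ?p2.0 = 0 and ?p3.0 = 0 and ?q12.0 = 0 and ?q13.0 = 0 and ?q22.0 = 1 and ?q23.0 = 0 and ?q33.0 = 0, simplified]
      by (simp add: algebra_simps)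
    show 2: "HX b z = - HY a z"
      using e0 E3[where z = z and ?p1.0 = 0 and ?p2.0 = 0 and ?p3.0 = 0 and ?q12.0 = 1 and ?q13.0 = 0 and ?q22.0 = 0 and ?q23.0 = 0 and ?q33.0 = 0, simplified]
      by (simp add: algebra_simps)
    show "HX c z = 2 * b z + 2 * yc z * HX a z + 2 * xc z * HY a z"
      using e0 E3[where z = z and ?p1.0 = 0 and ?p2.0 = 0 and ?p3.0 = 0 and ?q12.0 = 0 and ?q13.0 = 1 and ?q22.0 = 0 and ?q23.0 = 0 and ?q33.0 = 0, simplified]
      by (simp add: algebra_simps)
    show "HY c z = - 2 * a z - 2 * xc z * HX a z + 2 * yc z * HY a z"
      using e0 E3[where z = z and ?p1.0 = 0 and ?p2.0 = 0 and ?p3.0 = 0 and ?q12.0 = 0 and ?q13.0 = 0 and ?q22.0 = 0 and ?q23.0 = 1 and ?q33.0 = 0, simplified]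
      by (simp add: algebra_simps 1 2)
  qed
  have sm: "jet_smooth \<alpha>" "jet_smooth \<beta>" "jet_smooth a" using \<alpha> \<beta> base by (simp_all add: base_function_smooth)
  have Lh: "sublaplacian h z = sublaplacian \<alpha> z * uc z + sublaplacian \<beta> z" for z
    unfolding h using sm by (simp add: sublaplacian_explicit algebra_simps)
  have upd: "f (z(Deriv {#} := s)) = f z" if "base_function f" for f z s
    using that unfolding base_function_def depends_on_def by auto
  have main: "\<beta> z + sublaplacian \<beta> z + (sublaplacian \<alpha> z + 2 * HX a z) * uc z = 0" for z
    using eqs(7)[of z] Lh[of z] by (simp add: h algebra_simps)
  have bL: "base_function (sublaplacian f)" if "base_function f" for f
    unfolding sublaplacian_def[abs_def] by (intro base_function_intros base_function_HX base_function_HY that)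
  \<comment> \<open>The coefficients are base functions, so moving u alone to an arbitrary value
    \<open>s\<close> separates the two parts of the identity.\<close>
  have main2: "\<beta> z + sublaplacian \<beta> z + (sublaplacian \<alpha> z + 2 * HX a z) * s = 0" for z s
    using main[of "z(Deriv {#} := s)"] upd[OF \<beta>] upd[OF bL[OF \<beta>]] upd[OF bL[OF \<alpha>]]
      upd[OF base_function_HX[OF base(1)]] by simp
  have 1: "sublaplacian \<beta> z + \<beta> z = 0" for z using main2[of z 0] by simp
  have 2: "sublaplacian \<alpha> z = - 2 * HX a z" for z using main2[of z 1] 1[of z] by simp
  show thesis
    by (rule that[of a b c \<alpha> \<beta>]) (use eqs base \<alpha> \<beta> h 1 2 in \<open>auto simp: defs\<close>)
qed

text \<open>
  The last equation follows by applying \<open>[X, Y] = - 4 \<partial>\<^sub>t\<close> to \<open>\<psi> = X\<^sup>2 \<theta>\<close>: since \<open>X \<psi> = - 6 \<partial>\<^sub>t Y \<theta>\<close> and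
  \<open>Y \<psi> = 6 \<partial>\<^sub>t X \<theta>\<close>, the bracket also equals \<open>12 \<partial>\<^sub>t \<psi>\<close>.
\<close>

lemma frame_conformal_potential:
  assumes \<theta>: "jet_smooth \<theta>"
    and 1: "HX (HX \<theta>) = HY (HY \<theta>)" and 2: "\<And>z. HY (HX \<theta>) z = - HX (HY \<theta>) z"
  shows "HX (HY \<theta>) = (\<lambda>z. - 2 * pd (Indep 3) \<theta> z)"
    and "HY (HX \<theta>) = (\<lambda>z. 2 * pd (Indep 3) \<theta> z)"
    and "sublaplacian (HX \<theta>) z = - 4 * pd (Indep 3) (HY \<theta>) z"
    and "sublaplacian (HY \<theta>) z = 4 * pd (Indep 3) (HX \<theta>) z"
    and "pd (Indep 3) (HX (HX \<theta>)) = (\<lambda>z. 0)"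
proof -
  let ?T = "pd (Indep 3)"
  note sm = \<theta> HX_smooth[OF \<theta>] HY_smooth[OF \<theta>] HX_smooth[OF HX_smooth[OF \<theta>]] HY_smooth[OF HY_smooth[OF \<theta>]]
  note comm = HX_HY_commutator[THEN fun_cong]
  have xy: "HX (HY \<theta>) z = - 2 * ?T \<theta> z" for z
    using comm[OF \<theta>, of z] 2[of z] by linarith
  then show XY: "HX (HY \<theta>) = (\<lambda>z. - 2 * ?T \<theta> z)" by (rule ext)
  show YX: "HY (HX \<theta>) = (\<lambda>z. 2 * ?T \<theta> z)" using xy 2 by (intro ext) simp
  have XXY: "HX (HX (HY \<theta>)) z = - 2 * ?T (HX \<theta>) z" for z
    unfolding XY by (simp add: HX_pd3 \<theta>)
  have YYX: "HY (HY (HX \<theta>)) z = 2 * ?T (HY \<theta>) z" for z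
    unfolding YX by (simp add: HY_pd3 \<theta>)
  have XYX: "HX (HY (HX \<theta>)) z = 2 * ?T (HX \<theta>) z" for z
    unfolding YX by (simp add: HX_pd3 \<theta>)
  have YXY: "HY (HX (HY \<theta>)) z = - 2 * ?T (HY \<theta>) z" for z
    unfolding XY by (simp add: HY_pd3 \<theta>)
  have YXX: "HY (HX (HX \<theta>)) = (\<lambda>z. 6 * ?T (HX \<theta>) z)"
  proof
    fix z show "HY (HX (HX \<theta>)) z = 6 * ?T (HX \<theta>) z" using comm[OF sm(2), of z] XYX[of z] by linarith
  qed
  have XYY: "HX (HY (HY \<theta>)) = (\<lambda>z. - 6 * ?T (HY \<theta>) z)"
  proof
    fix z show "HX (HY (HY \<theta>)) z = - 6 * ?T (HY \<theta>) z" using comm[OF sm(3), of z] YXY[of z] by linarith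
  qed
  show "sublaplacian (HX \<theta>) z = - 4 * ?T (HY \<theta>) z"
    unfolding sublaplacian_def 1 XYY YYX by simp
  show "sublaplacian (HY \<theta>) z = 4 * ?T (HX \<theta>) z"
    unfolding sublaplacian_def 1[symmetric] YXX XXY by simp
  have Y\<psi>: "HY (HX (HX (HX \<theta>))) z = - 6 * ?T (HX (HX \<theta>)) z" for z
    unfolding 1 XYY by (simp add: HY_pd3 sm)
  have X\<psi>: "HX (HY (HX (HX \<theta>))) z = 6 * ?T (HX (HX \<theta>)) z" for z
    unfolding YXX by (simp add: HX_pd3 sm)
  show "?T (HX (HX \<theta>)) = (\<lambda>z. 0)"
  proof
    fix z show "?T (HX (HX \<theta>)) z = 0" using comm[OF sm(4), of z] Y\<psi>[of z] X\<psi>[of z] by linarith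
  qed
qed

lemma lie_point_symmetry_classification:
  assumes "lie_point_symmetry heisenberg_eq S"
  obtains c0 r c1 c2 \<kappa> \<beta> where
    "xi S 1 = (\<lambda>z. r * yc z + c1)" "xi S 2 = (\<lambda>z. - r * xc z + c2)"
    "xi S 3 = (\<lambda>z. c0 - 2 * c1 * yc z + 2 * c2 * xc z)" "eta S = (\<lambda>z. \<kappa> * uc z + \<beta> z)"
    "base_function \<beta>" "\<And>z. sublaplacian \<beta> z + \<beta> z = 0"
proof -
  obtain a b c \<alpha> \<beta> where S: "xi S 1 = a" "xi S 2 = b" "xi S 3 = c" "eta S = (\<lambda>z. \<alpha> z * uc z + \<beta> z)"
    and base: "base_function a" "base_function b" "base_function c" "base_function \<alpha>" "base_function \<beta>"
    and Yb: "\<And>z. HY b z = HX a z" and Xb: "\<And>z. HX b z = - HY a z"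
    and Xc: "\<And>z. HX c z = 2 * b z + 2 * yc z * HX a z + 2 * xc z * HY a z"
    and Yc: "\<And>z. HY c z = - 2 * a z - 2 * xc z * HX a z + 2 * yc z * HY a z"
    and X\<alpha>: "\<And>z. 2 * HX \<alpha> z = sublaplacian a z" and Y\<alpha>: "\<And>z. 2 * HY \<alpha> z = sublaplacian b z"
    and L\<alpha>: "\<And>z. sublaplacian \<alpha> z = - 2 * HX a z" and L\<beta>: "\<And>z. sublaplacian \<beta> z + \<beta> z = 0"
    by (rule lie_point_symmetry_components[OF assms]) (rule that)
  let ?T = "pd (Indep 3)"
  note sm [simp] = base[THEN base_function_smooth]
  \<comment> \<open>The contact form dt - 2y dx + 2x dy evaluated on (a, b, c). Since the form kills
    X and Y, the equations for \<open>c\<close> reduce to first derivatives of a single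
    function.\<close>
  define \<theta> where "\<theta> = (\<lambda>z. c z - 2 * yc z * a z + 2 * xc z * b z)"
  have \<theta> [simp]: "jet_smooth \<theta>" unfolding \<theta>_def by simp
  have "HX \<theta> z = 4 * b z" for z unfolding \<theta>_def by (simp add: Xc Xb algebra_simps)
  then have X\<theta>: "HX \<theta> = (\<lambda>z. 4 * b z)" by (rule ext)
  have "HY \<theta> z = - 4 * a z" for z unfolding \<theta>_def by (simp add: Yc Yb algebra_simps)
  then have Y\<theta>: "HY \<theta> = (\<lambda>z. - 4 * a z)" by (rule ext)
  have 1: "HX (HX \<theta>) = HY (HY \<theta>)" unfolding X\<theta> Y\<theta> by (simp add: Xb fun_eq_iff)
  have 2: "HY (HX \<theta>) z = - HX (HY \<theta>) z" for z unfolding X\<theta> Y\<theta> by (simp add: Yb)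
  note pot = frame_conformal_potential[OF \<theta> 1 2]
  have La: "sublaplacian a z = - ?T (HX \<theta>) z" for z
    using pot(4)[of z] unfolding Y\<theta> by (simp add: sublaplacian_def)
  have Lb: "sublaplacian b z = - ?T (HY \<theta>) z" for z
    using pot(3)[of z] unfolding X\<theta> by (simp add: sublaplacian_def)
  have Xa: "HX a z = 1/2 * ?T \<theta> z" for z
    using pot(1)[THEN fun_cong, of z] unfolding Y\<theta> by simp
  have "HX (\<lambda>z. 2 * HX \<alpha> z) = HX (\<lambda>z. - ?T (HX \<theta>) z)" using X\<alpha> La by simp
  then have XX\<alpha>: "2 * HX (HX \<alpha>) z = - ?T (HX (HX \<theta>)) z" for z by (simp add: HX_pd3 fun_eq_iff)
  have "HY (\<lambda>z. 2 * HY \<alpha> z) = HY (\<lambda>z. - ?T (HY \<theta>) z)" using Y\<alpha> Lb by simp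
  then have YY\<alpha>: "2 * HY (HY \<alpha>) z = - ?T (HX (HX \<theta>)) z" for z by (simp add: HY_pd3 1 fun_eq_iff)
  \<comment> \<open>Both second frame derivatives of \<alpha> are multiples of d/dt (X^2 \<theta>),
    which is zero. Hence Delta \<alpha> = 0, and the right-hand side -2 X a = - d\<theta>/dt must
    vanish.\<close>
  have "?T \<theta> z = 0" for z
    using L\<alpha>[of z] XX\<alpha>[of z] YY\<alpha>[of z] pot(5) Xa[of z] by (simp add: sublaplacian_def)
  then have T\<theta>: "?T \<theta> = (\<lambda>z. 0)" by (rule ext)
  have Xa0: "HX a = (\<lambda>z. 0)" using Xa T\<theta> by auto
  have Yb0: "HY b = (\<lambda>z. 0)" using Xa0 Yb by (intro ext) simp
  have TX: "?T (HX \<theta>) = (\<lambda>z. 0)" using HX_pd3[OF \<theta>] T\<theta> by simp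
  have TY: "?T (HY \<theta>) = (\<lambda>z. 0)" using HY_pd3[OF \<theta>] T\<theta> by simp
  have Tb: "?T b = (\<lambda>z. 0)" using TX unfolding X\<theta> by (simp add: fun_eq_iff)
  have Ta: "?T a = (\<lambda>z. 0)" using TY unfolding Y\<theta> by (simp add: fun_eq_iff)
  have "HX \<alpha> = (\<lambda>z. 0)" "HY \<alpha> = (\<lambda>z. 0)"
    using X\<alpha> Y\<alpha> La Lb TX TY by (auto intro!: ext)
  then obtain \<kappa> where \<kappa>: "\<alpha> = (\<lambda>z. \<kappa>)" using base_function_frame_constant[OF base(4)] by blast
  have b_frame: "base_function (HY a)"
    using base(1) unfolding HY_def[abs_def] by (intro base_function_intros) auto
  have TYa: "?T (HY a) = (\<lambda>z. 0)" using HY_pd3[of a] Ta by simp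
  have XYa: "HX (HY a) = (\<lambda>z. 0)"
    using HX_HY_commutator[of a] Ta Xa0 by (simp add: fun_eq_iff)
  have YYa: "HY (HY a) = (\<lambda>z. 0)"
  proof -
    have "HY (HX b) = (\<lambda>z. 0)" using HX_HY_commutator[of b] Tb Yb0 by (simp add: fun_eq_iff)
    moreover have "HX b = (\<lambda>z. - HY a z)" using Xb by (rule ext)
    ultimately show ?thesis by (simp add: fun_eq_iff)
  qed
  obtain r where r: "HY a = (\<lambda>z. r)" using base_function_frame_constant[OF b_frame XYa YYa] .
  \<comment> \<open>For each component, subtracting the expected linear part leaves a function
    killed by X and Y; its constant value is the next parameter.\<close>
  have "base_function (\<lambda>z. a z - r * yc z)" using base by (intro base_function_intros) auto
  then obtain c1 where "(\<lambda>z. a z - r * yc z) = (\<lambda>z. c1)"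
    by (rule base_function_frame_constant) (simp_all add: Xa0 r)
  then have a: "a = (\<lambda>z. r * yc z + c1)" by (auto simp: fun_eq_iff algebra_simps)
  have "base_function (\<lambda>z. b z + r * xc z)" using base by (intro base_function_intros) auto
  then obtain c2 where "(\<lambda>z. b z + r * xc z) = (\<lambda>z. c2)"
    by (rule base_function_frame_constant) (simp_all add: Yb0 r Xb fun_eq_iff)
  then have b: "b = (\<lambda>z. - r * xc z + c2)" by (auto simp: fun_eq_iff algebra_simps)
  have HXc: "HX c z = 2 * c2" for z using Xc[of z] Xa0 r by (simp add: b fun_eq_iff)
  have HYc: "HY c z = - 2 * c1" for z using Yc[of z] Xa0 r by (simp add: a fun_eq_iff)
  have Tc: "?T c z = 0" for z
  proof -
    have e: "HX c = (\<lambda>z. 2 * c2)" "HY c = (\<lambda>z. - 2 * c1)" using HXc HYc by auto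
    show ?thesis using HX_HY_commutator[OF sm(3), THEN fun_cong, of z] unfolding e by simp
  qed
  have "base_function (\<lambda>z. c z + 2 * c1 * yc z - 2 * c2 * xc z)" using base by (intro base_function_intros) auto
  then obtain c0 where "(\<lambda>z. c z + 2 * c1 * yc z - 2 * c2 * xc z) = (\<lambda>z. c0)"
    by (rule base_function_frame_constant) (simp_all add: HXc HYc fun_eq_iff)
  then have c: "c = (\<lambda>z. c0 - 2 * c1 * yc z + 2 * c2 * xc z)" by (auto simp: fun_eq_iff algebra_simps)
  show thesis
    by (rule that[of r c1 c2 c0 \<kappa> \<beta>]) (use S a b c \<kappa> base L\<beta> in auto)
qed

section \<open>The symmetry algebra\<close>

text \<open>This is c0 T + r R + c1 X~ + c2 Y~ + h d/du. The last component is kept general so that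
  the candidates with \<kappa> u + \<beta> are covered as well.\<close>

definition heis_field :: "real \<Rightarrow> real \<Rightarrow> real \<Rightarrow> real \<Rightarrow> (jet \<Rightarrow> real) \<Rightarrow> vector_field" where
  "heis_field c0 r c1 c2 h =
    vf (\<lambda>z. r * yc z + c1) (\<lambda>z. - r * xc z + c2) (\<lambda>z. c0 - 2 * c1 * yc z + 2 * c2 * xc z) h"

lemma heis_field_sel [simp]:
  "xi (heis_field c0 r c1 c2 h) 1 = (\<lambda>z. r * yc z + c1)"
  "xi (heis_field c0 r c1 c2 h) 2 = (\<lambda>z. - r * xc z + c2)"
  "xi (heis_field c0 r c1 c2 h) 3 = (\<lambda>z. c0 - 2 * c1 * yc z + 2 * c2 * xc z)"
  "eta (heis_field c0 r c1 c2 h) = h"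
  by (simp_all add: heis_field_def vf_def)

lemma vector_field_eqI:
  assumes "xi S 1 = xi S' 1" "xi S 2 = xi S' 2" "xi S 3 = xi S' 3" "eta S = eta S'"
  shows "S = S'"
proof (rule vector_field.expand)
  have "xi S i = xi S' i" for i using exhaust_3[of i] assms by auto
  then show "xi S = xi S' \<and> eta S = eta S'" using assms by auto
qed

lemma vf_sel [simp]: "xi (vf a b c h) 1 = a" "xi (vf a b c h) 2 = b" "xi (vf a b c h) 3 = c" "eta (vf a b c h) = h"
  by (simp_all add: vf_def)

lemma heis_field_point:
  assumes "point_function h"
  shows "point_vector_field (heis_field c0 r c1 c2 h)"
proof -
  have "point_function (xi (heis_field c0 r c1 c2 h) i)" for i
    using exhaust_3[of i] by (auto intro!: base_function_point base_function_intros)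
  then show ?thesis using assms by (simp add: point_vector_field_def)
qed

text \<open>Makes the expansion \<open>pr2_jet2\<close> available at an arbitrary jet.\<close>

lemma jet2_self: "jet2 z (z (Deriv {#1#})) (z (Deriv {#2#})) (z (Deriv {#3#})) (z (Deriv {#1, 1#})) (z (Deriv {#1, 2#}))
   (z (Deriv {#1, 3#})) (z (Deriv {#2, 2#})) (z (Deriv {#2, 3#})) (z (Deriv {#3, 3#})) = z"
  by (auto simp: jet2_def fun_eq_iff)

lemma heis_field_lie_symmetry:
  assumes \<beta>: "base_function \<beta>" "\<And>z. sublaplacian \<beta> z + \<beta> z = 0"
  shows "lie_point_symmetry heisenberg_eq (heis_field c0 r c1 c2 \<beta>)"
  unfolding lie_point_symmetry_def
proof (intro conjI allI impI)
  show S: "point_vector_field (heis_field c0 r c1 c2 \<beta>)" using \<beta> by (simp add: heis_field_point)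
  fix z assume z: "heisenberg_eq z = 0"
  have b: "sublaplacian \<beta> z = - \<beta> z" using \<beta>(2)[of z] by simp
  have c: "HY (\<lambda>z. - r * xc z + c2) z = 0" "HX (\<lambda>z. - r * xc z + c2) z = - r" by simp_all
  have "z (Deriv {#1, 1#}) = - uc z - z (Deriv {#2, 2#}) - 4 * ((xc z)\<^sup>2 + (yc z)\<^sup>2) * z (Deriv {#3, 3#})
     - 4 * yc z * z (Deriv {#1, 3#}) + 4 * xc z * z (Deriv {#2, 3#})"
    using z by (simp add: heisenberg_eq_explicit)
  then show "pr2 (heis_field c0 r c1 c2 \<beta>) heisenberg_eq z = 0"
    using pr2_jet2[OF S refl refl refl, of z "z (Deriv {#1#})" "z (Deriv {#2#})" "z (Deriv {#3#})" "z (Deriv {#1, 1#})" "z (Deriv {#1, 2#})"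
      "z (Deriv {#1, 3#})" "z (Deriv {#2, 2#})" "z (Deriv {#2, 3#})" "z (Deriv {#3, 3#})", unfolded jet2_self]
    using \<beta>(1) by (simp add: base_function_smooth sublaplacian_def[abs_def] b[unfolded sublaplacian_def]) (simp add: algebra_simps)
qed

text \<open>The horizontal part is divergence free and acts on (X u, Y u) by an infinitesimal
  rotation, so it preserves ((X u)^2 + (Y u)^2 - u^2) / 2. Only the first variation of the
  Lagrangian in direction \<open>h\<close> is left.\<close>

lemma pr1_heis_field_lagrangian:
  assumes h: "point_function h"
  shows "pr1 (heis_field c0 r c1 c2 h) heisenberg_lagrangian z
      + heisenberg_lagrangian z * (\<Sum>i\<in>UNIV. total_deriv i (xi (heis_field c0 r c1 c2 h) i) z) =
    HX h z * (z (Deriv {#1#}) + 2 * yc z * z (Deriv {#3#})) + HY h z * (z (Deriv {#2#}) - 2 * xc z * z (Deriv {#3#}))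
    + pd (Deriv {#}) h z * ((z (Deriv {#1#}) + 2 * yc z * z (Deriv {#3#}))\<^sup>2 + (z (Deriv {#2#}) - 2 * xc z * z (Deriv {#3#}))\<^sup>2)
    - h z * uc z"
  unfolding pr1_def vf_apply_def eta1_def heisenberg_lagrangian_def[abs_def]
  apply (simp add: sum_3 h total_deriv_point HX_def HY_def) apply (simp add: algebra_simps power2_eq_square) done

text \<open>Green's identity. The flux is u (X\<beta>) X + u (Y\<beta>) Y in coordinates; as X and Y
  are divergence free, its divergence is X\<beta> X u + Y\<beta> Y u + u Delta \<beta>, and Delta
  \<beta> = - \<beta>.\<close>

lemma divergence_green:
  assumes \<beta>: "base_function \<beta>" "\<And>z. sublaplacian \<beta> z + \<beta> z = 0"
  obtains \<phi> :: "3 \<Rightarrow> jet \<Rightarrow> real" where "\<And>i. differential_function (\<phi> i)"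
    "\<And>z. (\<Sum>i\<in>UNIV. total_deriv i (\<phi> i) z) =
      HX \<beta> z * (z (Deriv {#1#}) + 2 * yc z * z (Deriv {#3#})) + HY \<beta> z * (z (Deriv {#2#}) - 2 * xc z * z (Deriv {#3#}))
      - \<beta> z * uc z"
proof
  define \<phi> :: "3 \<Rightarrow> jet \<Rightarrow> real" where "\<phi> i = (if i = 1 then (\<lambda>z. uc z * HX \<beta> z) else if i = 2 then (\<lambda>z. uc z * HY \<beta> z)
    else (\<lambda>z. uc z * (2 * yc z * HX \<beta> z - 2 * xc z * HY \<beta> z)))" for i
  show "differential_function (\<phi> i)" for i using \<beta>(1) by (simp add: \<phi>_def)
  fix z
  have b: "\<beta> z = - sublaplacian \<beta> z" using \<beta>(2)[of z] by simp
  show "(\<Sum>i\<in>UNIV. total_deriv i (\<phi> i) z) =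
      HX \<beta> z * (z (Deriv {#1#}) + 2 * yc z * z (Deriv {#3#})) + HY \<beta> z * (z (Deriv {#2#}) - 2 * xc z * z (Deriv {#3#}))
      - \<beta> z * uc z"
    unfolding b using \<beta>(1) by (simp add: sum_3 \<phi>_def total_deriv_base sublaplacian_def HX_def[of "HX \<beta>"] HY_def[of "HY \<beta>"] algebra_simps)
qed

lemma heis_field_noether:
  assumes \<beta>: "base_function \<beta>" "\<And>z. sublaplacian \<beta> z + \<beta> z = 0"
  shows "noether_symmetry heisenberg_eq heisenberg_lagrangian (heis_field c0 r c1 c2 \<beta>)"
proof -
  obtain \<phi> :: "3 \<Rightarrow> jet \<Rightarrow> real" where "\<And>i. differential_function (\<phi> i)"
    "\<And>z. (\<Sum>i\<in>UNIV. total_deriv i (\<phi> i) z) =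
      HX \<beta> z * (z (Deriv {#1#}) + 2 * yc z * z (Deriv {#3#})) + HY \<beta> z * (z (Deriv {#2#}) - 2 * xc z * z (Deriv {#3#}))
      - \<beta> z * uc z" by (rule divergence_green[OF \<beta>]) (rule that)
  then show ?thesis unfolding noether_symmetry_def
    using heis_field_lie_symmetry[OF \<beta>] \<beta>(1) by (intro conjI exI[of _ \<phi>]) (simp_all add: pr1_heis_field_lagrangian)
qed

text \<open>The explicit set with which both the generated Lie algebra and the set of Noether
  symmetries are compared.\<close>

definition heis_algebra :: "vector_field set" where
  "heis_algebra = {heis_field c0 r c1 c2 \<beta> | c0 r c1 c2 \<beta>. base_function \<beta> \<and> (\<forall>z. sublaplacian \<beta> z + \<beta> z = 0)}"

lemma subspace_heis_algebra: "subspace heis_algebra"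
  unfolding subspace_def
proof (intro conjI ballI allI)
  have "(0 :: vector_field) = heis_field 0 0 0 0 (\<lambda>z. 0)"
    by (rule vector_field_eqI) (simp_all add: zero_vector_field_def)
  then show "0 \<in> heis_algebra" unfolding heis_algebra_def
    by (auto simp: sublaplacian_def[abs_def] intro!: base_function_const exI)
  fix S assume "S \<in> heis_algebra"
  then obtain c0 r c1 c2 \<beta> where S: "S = heis_field c0 r c1 c2 \<beta>" "base_function \<beta>" "\<And>z. sublaplacian \<beta> z + \<beta> z = 0"
    unfolding heis_algebra_def by auto
  {
    fix S' assume "S' \<in> heis_algebra"
    then obtain c0' r' c1' c2' \<beta>' where S': "S' = heis_field c0' r' c1' c2' \<beta>'" "base_function \<beta>'" "\<And>z. sublaplacian \<beta>' z + \<beta>' z = 0"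
      unfolding heis_algebra_def by auto
    have "S + S' = heis_field (c0 + c0') (r + r') (c1 + c1') (c2 + c2') (\<lambda>z. \<beta> z + \<beta>' z)"
      by (rule vector_field_eqI) (simp_all add: plus_vector_field_def S(1) S'(1) fun_eq_iff algebra_simps)
    moreover have "base_function (\<lambda>z. \<beta> z + \<beta>' z)" using S S' by (intro base_function_intros)
    moreover have "sublaplacian (\<lambda>z. \<beta> z + \<beta>' z) z + (\<beta> z + \<beta>' z) = 0" for z
      using S(3)[of z] S'(3)[of z] S(2) S'(2) by (simp add: sublaplacian_def base_function_smooth)
    ultimately show "S + S' \<in> heis_algebra" unfolding heis_algebra_def by blast
  }
  {
    fix k :: real
    have "k *\<^sub>R S = heis_field (k * c0) (k * r) (k * c1) (k * c2) (\<lambda>z. k * \<beta> z)"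
      by (rule vector_field_eqI) (simp_all add: scaleR_vector_field_def S(1) fun_eq_iff algebra_simps)
    moreover have "base_function (\<lambda>z. k * \<beta> z)" using S by (intro base_function_intros)
    moreover have "sublaplacian (\<lambda>z. k * \<beta> z) z + k * \<beta> z = 0" for z
      using S(2) arg_cong[OF S(3)[of z], of "\<lambda>t. k * t"] by (simp add: sublaplacian_def base_function_smooth algebra_simps)
    ultimately show "k *\<^sub>R S \<in> heis_algebra" unfolding heis_algebra_def by blast
  }
qed

text \<open>The field rewritten in the frame X, Y, d/dt; the coefficient of d/dt is its contact
  potential.\<close>

lemma vf_apply_heis_field_base:
  assumes "base_function f"
  shows "vf_apply (heis_field c0 r c1 c2 h) f = (\<lambda>z. (r * yc z + c1) * HX f z + (- r * xc z + c2) * HY f z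
    + (c0 - 4 * c1 * yc z + 4 * c2 * xc z - 2 * r * ((xc z)\<^sup>2 + (yc z)\<^sup>2)) * pd (Indep 3) f z)"
  using assms by (simp add: vf_apply_def sum_3 fun_eq_iff HX_def HY_def) (simp add: algebra_simps power2_eq_square)

lemma base_function_vf_apply_heis_field:
  assumes "base_function f"
  shows "base_function (vf_apply (heis_field c0 r c1 c2 h) f)"
  unfolding vf_apply_heis_field_base[OF assms] power2_eq_square
  by (intro base_function_intros) (use assms in auto)

text \<open>On base functions the field Z satisfies [Z, X] = r Y and, for the lemma after this one,
  [Z, Y] = - r X: T, X~, Y~ commute with the frame and R rotates it.\<close>

lemma HX_vf_apply_heis_field:
  assumes f: "base_function f"
  shows "HX (vf_apply (heis_field c0 r c1 c2 h) f) z = vf_apply (heis_field c0 r c1 c2 h) (HX f) z - r * HY f z"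
  using f HX_HY_commutator[of f]
  by (simp add: vf_apply_heis_field_base base_function_smooth power2_eq_square HX_pd3 fun_eq_iff) (simp add: algebra_simps)

lemma HY_vf_apply_heis_field:
  assumes f: "base_function f"
  shows "HY (vf_apply (heis_field c0 r c1 c2 h) f) z = vf_apply (heis_field c0 r c1 c2 h) (HY f) z + r * HX f z"
  using f HX_HY_commutator[of f]
  by (simp add: vf_apply_heis_field_base base_function_smooth power2_eq_square HY_pd3 fun_eq_iff) (simp add: algebra_simps)

text \<open>The rotation terms from X^2 and Y^2 cancel, so Z commutes with Delta and maps solutions
  to solutions. This keeps the bracket of a field with some \<open>W_field\<close> inside the
  algebra.\<close>

lemma sublaplacian_vf_apply_heis_field:
  assumes f: "base_function f" and eq: "\<And>z. sublaplacian f z + f z = 0"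
  shows "sublaplacian (vf_apply (heis_field c0 r c1 c2 h) f) z + vf_apply (heis_field c0 r c1 c2 h) f z = 0"
proof -
  let ?Z = "vf_apply (heis_field c0 r c1 c2 h)"
  note sm = base_function_vf_apply_heis_field[THEN base_function_smooth] base_function_smooth
  have X: "HX (?Z f) = (\<lambda>z. ?Z (HX f) z - r * HY f z)" by (rule ext) (rule HX_vf_apply_heis_field[OF f])
  have Y: "HY (?Z f) = (\<lambda>z. ?Z (HY f) z + r * HX f z)" by (rule ext) (rule HY_vf_apply_heis_field[OF f])
  have XX: "HX (HX (?Z f)) z = ?Z (HX (HX f)) z - r * HY (HX f) z - r * HX (HY f) z"
    unfolding X using f by (simp add: sm HX_vf_apply_heis_field)
  have YY: "HY (HY (?Z f)) z = ?Z (HY (HY f)) z + r * HX (HY f) z + r * HY (HX f) z"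
    unfolding Y using f by (simp add: sm HY_vf_apply_heis_field)
  have "f = (\<lambda>z. - HX (HX f) z - HY (HY f) z)" proof
    fix z show "f z = - HX (HX f) z - HY (HY f) z" using eq[of z] by (simp add: sublaplacian_def)
  qed
  then have "?Z f z = ?Z (\<lambda>z. - HX (HX f) z - HY (HY f) z) z" by simp
  also have "\<dots> = - ?Z (HX (HX f)) z - ?Z (HY (HY f)) z"
    using f by (simp add: vf_apply_def sum_3 sm algebra_simps)
  finally show ?thesis by (simp add: sublaplacian_def XX YY)
qed

text \<open>Structure constants: [X~, Y~] = 4 T, [R, X~] = Y~, [R, Y~] = - X~, and T commutes with
  R, X~ and Y~.\<close>

lemma lie_bracket_heis_field:
  assumes "base_function \<beta>" "base_function \<beta>'"
  shows "lie_bracket (heis_field c0 r c1 c2 \<beta>) (heis_field c0' r' c1' c2' \<beta>') =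
    heis_field (4 * (c1 * c2' - c2 * c1')) 0 (c2 * r' - c2' * r) (c1' * r - c1 * r')
      (\<lambda>z. vf_apply (heis_field c0 r c1 c2 \<beta>) \<beta>' z - vf_apply (heis_field c0' r' c1' c2' \<beta>') \<beta> z)"
  by (rule vector_field_eqI) (simp_all add: lie_bracket_def vf_apply_def sum_3 fun_eq_iff algebra_simps)

lemma lie_subalgebra_heis_algebra: "lie_subalgebra heis_algebra"
  unfolding lie_subalgebra_def
proof (intro conjI ballI subspace_heis_algebra)
  fix S S' assume "S \<in> heis_algebra" "S' \<in> heis_algebra"
  then obtain c0 r c1 c2 \<beta> c0' r' c1' c2' \<beta>' where
    S: "S = heis_field c0 r c1 c2 \<beta>" "base_function \<beta>" "\<And>z. sublaplacian \<beta> z + \<beta> z = 0" and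
    S': "S' = heis_field c0' r' c1' c2' \<beta>'" "base_function \<beta>'" "\<And>z. sublaplacian \<beta>' z + \<beta>' z = 0"
    unfolding heis_algebra_def by auto
  let ?\<gamma> = "\<lambda>z. vf_apply (heis_field c0 r c1 c2 \<beta>) \<beta>' z - vf_apply (heis_field c0' r' c1' c2' \<beta>') \<beta> z"
  have b: "base_function (vf_apply (heis_field c0 r c1 c2 \<beta>) \<beta>')" "base_function (vf_apply (heis_field c0' r' c1' c2' \<beta>') \<beta>)"
    using S S' by (simp_all add: base_function_vf_apply_heis_field)
  then have "base_function ?\<gamma>" by (intro base_function_intros)
  moreover have "sublaplacian ?\<gamma> z + ?\<gamma> z = 0" for z
    using sublaplacian_vf_apply_heis_field[OF S'(2,3), of c0 r c1 c2 \<beta> z]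
      sublaplacian_vf_apply_heis_field[OF S(2,3), of c0' r' c1' c2' \<beta>' z] b
    by (simp add: sublaplacian_def base_function_smooth)
  ultimately show "lie_bracket S S' \<in> heis_algebra"
    unfolding S(1) S'(1) lie_bracket_heis_field[OF S(2) S'(2)] heis_algebra_def by blast
qed

text \<open>The linear span of the generators is already closed under brackets, so generating adds
  nothing to it.\<close>

lemma lie_algebra_generated_heis:
  "lie_algebra_generated ({T_field, R_field, X_tilde, Y_tilde} \<union>
       {W_field \<beta> | \<beta>. base_function \<beta> \<and> (\<forall>z. kohn_laplace \<beta> z + \<beta> z = 0)}) = heis_algebra"
  (is "lie_algebra_generated ?G = _")
proof -
  have zero: "base_function (\<lambda>z. 0)" "sublaplacian (\<lambda>z. 0) z + 0 = 0" for z
    by (simp_all add: base_function_const sublaplacian_def)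
  have T: "T_field = heis_field 1 0 0 0 (\<lambda>z. 0)" and R: "R_field = heis_field 0 1 0 0 (\<lambda>z. 0)"
    and X: "X_tilde = heis_field 0 0 1 0 (\<lambda>z. 0)" and Y: "Y_tilde = heis_field 0 0 0 1 (\<lambda>z. 0)"
    by (rule vector_field_eqI; simp add: T_field_def R_field_def X_tilde_def Y_tilde_def)+
  have W: "W_field \<beta> = heis_field 0 0 0 0 \<beta>" for \<beta>
    by (rule vector_field_eqI; simp add: W_field_def)
  have "{T_field, R_field, X_tilde, Y_tilde} \<subseteq> heis_algebra"
    unfolding heis_algebra_def T R X Y using zero by blast
  moreover have "W_field \<beta> \<in> heis_algebra" if "base_function \<beta>" "\<forall>z. kohn_laplace \<beta> z + \<beta> z = 0" for \<beta>
    unfolding heis_algebra_def W using that kohn_laplace_base[OF that(1)] by fastforce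
  ultimately have "?G \<subseteq> heis_algebra" by blast
  moreover have "heis_algebra \<subseteq> A" if A: "lie_subalgebra A" "?G \<subseteq> A" for A
  proof
    fix S assume "S \<in> heis_algebra"
    then obtain c0 r c1 c2 \<beta> where S: "S = heis_field c0 r c1 c2 \<beta>" "base_function \<beta>" "\<And>z. sublaplacian \<beta> z + \<beta> z = 0"
      unfolding heis_algebra_def by auto
    have A': "subspace A" using A by (simp add: lie_subalgebra_def)
    have "W_field \<beta> \<in> A" using A(2) S(2,3) kohn_laplace_base[OF S(2)] by fastforce
    moreover have "S = c0 *\<^sub>R T_field + r *\<^sub>R R_field + c1 *\<^sub>R X_tilde + c2 *\<^sub>R Y_tilde + W_field \<beta>"
      unfolding S T R X Y W
      by (rule vector_field_eqI; simp add: scaleR_vector_field_def plus_vector_field_def fun_eq_iff algebra_simps)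
    moreover have "T_field \<in> A" "R_field \<in> A" "X_tilde \<in> A" "Y_tilde \<in> A" using A(2) by auto
    ultimately show "S \<in> A" using A' by (simp add: subspace_add subspace_scale)
  qed
  ultimately show ?thesis unfolding lie_algebra_generated_def
    using lie_subalgebra_heis_algebra by (intro hull_unique) auto
qed

section \<open>The Lagrangian is not a total divergence\<close>

lemma tendsto_jet:
  fixes g :: "'a \<Rightarrow> jet"
  assumes "\<And>c. ((\<lambda>s. g s c) \<longlongrightarrow> l c) F"
  shows "(g \<longlongrightarrow> l) F"
proof -
  have "limitin (product_topology (\<lambda>_. euclidean) UNIV) g l F"
    unfolding limitin_componentwise using assms by (auto simp: extensional_def)
  then show ?thesis by (simp add: euclidean_product_topology)
qed

text \<open>Smoothness here means continuous partial derivatives, with no total differential at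
  hand. The coordinates are therefore released one at a time, each by a mean value theorem whose
  intermediate point tends to the base point.\<close>

lemma jet_chain_rule_aux:
  assumes "finite V" "jet_smooth F"
    and "\<And>c. c \<in> V \<Longrightarrow> ((\<lambda>s. \<gamma> s c) has_real_derivative \<gamma>' c) (at s0)"
    and "\<And>c s. c \<notin> V \<Longrightarrow> \<gamma> s c = \<gamma> s0 c"
  shows "((\<lambda>s. F (\<gamma> s)) has_real_derivative (\<Sum>c\<in>V. pd c F (\<gamma> s0) * \<gamma>' c)) (at s0)"
  using assms(1,3,4)
proof (induction V arbitrary: \<gamma> rule: finite_induct)
  case empty
  have e: "\<gamma> s = \<gamma> s0" for s by (rule ext, rule empty.prems(2)) simp
  have "(\<lambda>s. F (\<gamma> s)) = (\<lambda>s. F (\<gamma> s0))" by (rule ext, rule arg_cong[of _ _ F], rule e)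
  then show ?case by simp
next
  case (insert c V)
  \<comment> \<open>The same curve with coordinate \<open>c\<close> frozen: the induction hypothesis
    treats \<delta>, and the mean value theorem treats the difference between \<gamma> and
    \<delta>.\<close>
  define \<delta> where "\<delta> s = (\<gamma> s)(c := \<gamma> s0 c)" for s
  have \<delta>0: "\<delta> s0 = \<gamma> s0" by (simp add: \<delta>_def)
  have 1: "((\<lambda>s. F (\<delta> s)) has_real_derivative (\<Sum>c\<in>V. pd c F (\<delta> s0) * \<gamma>' c)) (at s0)"
  proof (rule insert.IH)
    fix d assume "d \<in> V"
    then show "((\<lambda>s. \<delta> s d) has_real_derivative \<gamma>' d) (at s0)"
      using insert.prems(1)[of d] insert.hyps by (cases "d = c") (auto simp: \<delta>_def)
  next
    fix d s assume "d \<notin> V"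
    then show "\<delta> s d = \<delta> s0 d" using insert.prems(2)[of d s] by (auto simp: \<delta>_def)
  qed
  have mvt: "\<exists>\<xi>. \<bar>\<xi> - \<gamma> s0 c\<bar> \<le> \<bar>\<gamma> s c - \<gamma> s0 c\<bar> \<and>
    F (\<gamma> s) - F (\<delta> s) = pd c F ((\<gamma> s)(c := \<xi>)) * (\<gamma> s c - \<gamma> s0 c)" for s
  proof -
    have D: "((\<lambda>r. F ((\<gamma> s)(c := r))) has_real_derivative pd c F ((\<gamma> s)(c := r))) (at r)" for r
      by (rule jet_smooth_DERIV[OF assms(2)])
    consider "\<gamma> s c = \<gamma> s0 c" | "\<gamma> s0 c < \<gamma> s c" | "\<gamma> s c < \<gamma> s0 c" by linarith
    then show ?thesis
    proof cases
      case 1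
      then have "\<delta> s = \<gamma> s" by (simp add: \<delta>_def fun_eq_iff)
      then show ?thesis using 1 by (intro exI[of _ "\<gamma> s0 c"]) simp
    next
      case 2
      from MVT2[OF this D] obtain \<xi> where "\<gamma> s0 c < \<xi>" "\<xi> < \<gamma> s c"
        "F (\<gamma> s) - F (\<delta> s) = (\<gamma> s c - \<gamma> s0 c) * pd c F ((\<gamma> s)(c := \<xi>))" by (auto simp: \<delta>_def)
      then show ?thesis by (intro exI[of _ \<xi>]) (simp add: mult.commute)
    next
      case 3
      from MVT2[OF this D] obtain \<xi> where "\<gamma> s c < \<xi>" "\<xi> < \<gamma> s0 c"
        "F (\<delta> s) - F (\<gamma> s) = (\<gamma> s0 c - \<gamma> s c) * pd c F ((\<gamma> s)(c := \<xi>))" by (auto simp: \<delta>_def)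
      then show ?thesis by (intro exI[of _ \<xi>]) (simp add: algebra_simps)
    qed
  qed
  obtain \<xi> where "\<forall>s. \<bar>\<xi> s - \<gamma> s0 c\<bar> \<le> \<bar>\<gamma> s c - \<gamma> s0 c\<bar> \<and>
    F (\<gamma> s) - F (\<delta> s) = pd c F ((\<gamma> s)(c := \<xi> s)) * (\<gamma> s c - \<gamma> s0 c)"
    using choice[OF allI[OF mvt]] by (rule exE)
  then have \<xi>: "\<And>s. \<bar>\<xi> s - \<gamma> s0 c\<bar> \<le> \<bar>\<gamma> s c - \<gamma> s0 c\<bar>"
    "\<And>s. F (\<gamma> s) - F (\<delta> s) = pd c F ((\<gamma> s)(c := \<xi> s)) * (\<gamma> s c - \<gamma> s0 c)" by simp_all
  have lim: "((\<lambda>s. \<gamma> s d) \<longlongrightarrow> \<gamma> s0 d) (at s0)" for d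
  proof (cases "d \<in> insert c V")
    case True
    show ?thesis using DERIV_isCont[OF insert.prems(1)[OF True]] by (simp only: isCont_def)
  next
    case False
    have "(\<lambda>s. \<gamma> s d) = (\<lambda>s. \<gamma> s0 d)" by (rule ext) (rule insert.prems(2)[OF False])
    then show ?thesis by simp
  qed
  have "((\<lambda>s. \<gamma> s c - \<gamma> s0 c) \<longlongrightarrow> 0) (at s0)" using lim[of c] by (simp add: LIM_zero)
  then have "((\<lambda>s. \<xi> s - \<gamma> s0 c) \<longlongrightarrow> 0) (at s0)"
    by (rule Lim_transform_bound[rotated]) (use \<xi>(1) in \<open>simp add: always_eventually\<close>)
  then have \<xi>lim: "(\<xi> \<longlongrightarrow> \<gamma> s0 c) (at s0)" by (simp add: LIM_zero_iff)
  have "((\<lambda>s. (\<gamma> s)(c := \<xi> s)) \<longlongrightarrow> \<gamma> s0) (at s0)"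
  proof (rule tendsto_jet)
    fix d show "((\<lambda>s. ((\<gamma> s)(c := \<xi> s)) d) \<longlongrightarrow> \<gamma> s0 d) (at s0)"
      using lim[of d] \<xi>lim by (cases "d = c") auto
  qed
  then have pdlim: "((\<lambda>s. pd c F ((\<gamma> s)(c := \<xi> s))) \<longlongrightarrow> pd c F (\<gamma> s0)) (at s0)"
    by (rule continuous_on_tendsto_compose[OF jet_smooth_continuous[OF jet_smooth_pd[OF assms(2)]]]) auto
  have "((\<lambda>s. (\<gamma> s c - \<gamma> s0 c) / (s - s0)) \<longlongrightarrow> \<gamma>' c) (at s0)"
    using insert.prems(1)[of c] by (simp add: has_field_derivative_iff)
  from tendsto_mult[OF pdlim this]
  have "((\<lambda>s. ((F (\<gamma> s) - F (\<delta> s)) - (F (\<gamma> s0) - F (\<delta> s0))) / (s - s0)) \<longlongrightarrow> pd c F (\<gamma> s0) * \<gamma>' c) (at s0)"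
    by (simp add: \<xi>(2) \<delta>0)
  then have 2: "((\<lambda>s. F (\<gamma> s) - F (\<delta> s)) has_real_derivative pd c F (\<gamma> s0) * \<gamma>' c) (at s0)"
    by (simp add: has_field_derivative_iff)
  from DERIV_add[OF 2 1] show ?case using insert.hyps by (simp add: \<delta>0)
qed

text \<open>Freezing the coordinates that \<open>F\<close> does not see turns any curve into one
  covered by the previous lemma.\<close>

lemma jet_chain_rule:
  assumes V: "finite V" "depends_on V F" and F: "jet_smooth F"
    and \<gamma>: "\<And>c. c \<in> V \<Longrightarrow> ((\<lambda>s. \<gamma> s c) has_real_derivative \<gamma>' c) (at s0)"
  shows "((\<lambda>s. F (\<gamma> s)) has_real_derivative (\<Sum>c\<in>V. pd c F (\<gamma> s0) * \<gamma>' c)) (at s0)"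
proof -
  define \<delta> where "\<delta> s c = (if c \<in> V then \<gamma> s c else \<gamma> s0 c)" for s c
  have *: "F (\<gamma> s) = F (\<delta> s)" for s
    using V(2) unfolding depends_on_def \<delta>_def by simp
  have \<delta>0: "\<delta> s0 = \<gamma> s0" by (simp add: \<delta>_def fun_eq_iff)
  have "((\<lambda>s. F (\<delta> s)) has_real_derivative (\<Sum>c\<in>V. pd c F (\<delta> s0) * \<gamma>' c)) (at s0)"
    by (rule jet_chain_rule_aux[OF V(1) F]) (use \<gamma> in \<open>auto simp: \<delta>_def\<close>)
  then show ?thesis unfolding * \<delta>0 .
qed

text \<open>The jet at the point \<open>p\<close> of the function \<open>f\<^sub>1(x) f\<^sub>2(y) f\<^sub>3(t)\<close>.\<close>

definition separable_jet :: "(3 \<Rightarrow> real poly) \<Rightarrow> (3 \<Rightarrow> real) \<Rightarrow> jet" where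
  "separable_jet f p c = (case c of Indep i \<Rightarrow> p i
    | Deriv J \<Rightarrow> \<Prod>k\<in>UNIV. poly ((pderiv ^^ count J k) (f k)) (p k))"

lemma separable_jet_DERIV_coordinate:
  "((\<lambda>s. separable_jet f (p(i := s)) (Deriv J)) has_real_derivative
     separable_jet f p (Deriv (add_mset i J))) (at (p i))"
proof -
  let ?q = "\<lambda>k. poly ((pderiv ^^ count J k) (f k))"
  have e: "separable_jet f (p(i := s)) (Deriv J) = ?q i s * (\<Prod>k\<in>UNIV - {i}. ?q k (p k))" for s
  proof -
    have "(\<Prod>k\<in>UNIV - {i}. ?q k ((p(i := s)) k)) = (\<Prod>k\<in>UNIV - {i}. ?q k (p k))"
      by (rule prod.cong) auto
    then show ?thesis unfolding separable_jet_def by (simp add: prod.remove[of UNIV i])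
  qed
  have "separable_jet f p (Deriv (add_mset i J)) =
      poly (pderiv ((pderiv ^^ count J i) (f i))) (p i) * (\<Prod>k\<in>UNIV - {i}. ?q k (p k))"
  proof -
    have "(\<Prod>k\<in>UNIV - {i}. poly ((pderiv ^^ count (add_mset i J) k) (f k)) (p k)) = (\<Prod>k\<in>UNIV - {i}. ?q k (p k))"
      by (rule prod.cong) auto
    then show ?thesis unfolding separable_jet_def by (simp add: prod.remove[of UNIV i])
  qed
  then show ?thesis unfolding e
    by (auto intro!: derivative_eq_intros poly_DERIV)
qed

text \<open>Along the jets of an actual function a total derivative is an ordinary partial
  derivative, because the derivative of u_J in direction i is again the coordinate with i added to
  J.\<close>

lemma separable_jet_DERIV:
  assumes "differential_function F"
  shows "((\<lambda>s. F (separable_jet f (p(i := s)))) has_real_derivative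
     total_deriv i F (separable_jet f p)) (at (p i))"
proof -
  obtain V where V: "finite V" "depends_on V F" and F: "jet_smooth F"
    using assms unfolding differential_function_def by blast
  define M where "M = {J. Deriv J \<in> V}"
  define W where "W = range Indep \<union> Deriv ` M"
  have M: "finite M" unfolding M_def by (rule finite_Deriv_indices[OF V(1)])
  have W: "finite W" "V \<subseteq> W"
    using M by (auto simp: W_def M_def image_iff) (metis jet_coord.exhaust)
  define \<gamma>' where "\<gamma>' c = (case c of Indep k \<Rightarrow> if k = i then 1 else 0
    | Deriv J \<Rightarrow> separable_jet f p (Deriv (add_mset i J)))" for c
  have "((\<lambda>s. F (separable_jet f (p(i := s)))) has_real_derivative
     (\<Sum>c\<in>W. pd c F (separable_jet f (p(i := p i))) * \<gamma>' c)) (at (p i))"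
  proof (rule jet_chain_rule[OF W(1) depends_on_mono[OF V(2) W(2)] F])
    fix c
    show "((\<lambda>s. separable_jet f (p(i := s)) c) has_real_derivative \<gamma>' c) (at (p i))"
    proof (cases c)
      case (Indep k)
      then show ?thesis by (cases "k = i") (auto simp: \<gamma>'_def separable_jet_def)
    next
      case (Deriv J)
      then show ?thesis using separable_jet_DERIV_coordinate[of f p i J] by (simp add: \<gamma>'_def)
    qed
  qed
  also have "(\<Sum>c\<in>W. pd c F (separable_jet f (p(i := p i))) * \<gamma>' c) = total_deriv i F (separable_jet f p)"
  proof -
    have "(\<Sum>c\<in>W. pd c F (separable_jet f p) * \<gamma>' c) =
        (\<Sum>c\<in>range Indep. pd c F (separable_jet f p) * \<gamma>' c) + (\<Sum>c\<in>Deriv ` M. pd c F (separable_jet f p) * \<gamma>' c)"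
      unfolding W_def by (rule sum.union_disjoint) (use M in auto)
    also have "(\<Sum>c\<in>range Indep. pd c F (separable_jet f p) * \<gamma>' c) = pd (Indep i) F (separable_jet f p)"
      by (subst sum.reindex) (auto simp: inj_on_def \<gamma>'_def if_distrib cong: if_cong)
    also have "(\<Sum>c\<in>Deriv ` M. pd c F (separable_jet f p) * \<gamma>' c) =
        (\<Sum>J\<in>M. separable_jet f p (Deriv (add_mset i J)) * pd (Deriv J) F (separable_jet f p))"
      by (subst sum.reindex) (auto simp: inj_on_def \<gamma>'_def mult.commute)
    finally show ?thesis
      using total_deriv_eq[OF V(2) M, of i "separable_jet f p"] by (simp add: M_def)
  qed
  finally show ?thesis .
qed

section \<open>Iterated integrals over boxes\<close>

lemma continuous_on_total_deriv:
  assumes "differential_function F"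
  shows "continuous_on UNIV (total_deriv i F)"
proof -
  obtain V where V: "finite V" "depends_on V F" and F: "jet_smooth F"
    using assms unfolding differential_function_def by blast
  have "total_deriv i F = (\<lambda>z. pd (Indep i) F z + (\<Sum>J | Deriv J \<in> V. z (Deriv (add_mset i J)) * pd (Deriv J) F z))"
    using total_deriv_eq[OF V(2) finite_Deriv_indices[OF V(1)] subset_refl] by (rule ext)
  moreover have "continuous_on UNIV (\<lambda>z. pd (Indep i) F z + (\<Sum>J | Deriv J \<in> V. z (Deriv (add_mset i J)) * pd (Deriv J) F z))"
    by (rule jet_smooth_continuous) (use F in auto)
  ultimately show ?thesis by simp
qed

definition box_integral :: "(3 \<Rightarrow> real) \<Rightarrow> (3 \<Rightarrow> real) \<Rightarrow> (real \<Rightarrow> real \<Rightarrow> real \<Rightarrow> real) \<Rightarrow> real" where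
  "box_integral l u g = integral {l 1..u 1} (\<lambda>x. integral {l 2..u 2} (\<lambda>y. integral {l 3..u 3} (g x y)))"

definition continuous3 :: "(real \<Rightarrow> real \<Rightarrow> real \<Rightarrow> real) \<Rightarrow> bool" where
  "continuous3 g \<longleftrightarrow> continuous_on UNIV (\<lambda>(x, y, t). g x y t)"

lemma continuous3_compose:
  assumes g: "continuous3 g" and "continuous_on S a" "continuous_on S b" "continuous_on S c"
  shows "continuous_on S (\<lambda>s. g (a s) (b s) (c s))"
proof -
  have "continuous_on S (\<lambda>s. (a s, b s, c s))" by (intro continuous_on_Pair assms)
  from continuous_on_compose2[OF g[unfolded continuous3_def] this] show ?thesis by simp
qed

lemma continuous3_inner:
  assumes "continuous3 g"
  shows "continuous_on UNIV (\<lambda>(x, y). integral {a..b} (g x y))"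
proof -
  have "continuous_on UNIV (\<lambda>p. integral (cbox a b) (\<lambda>t. g (fst p) (snd p) t))"
    by (rule integral_continuous_on_param)
      (auto simp: split_beta intro!: continuous3_compose[OF assms] continuous_intros)
  then show ?thesis by (simp add: split_beta)
qed

lemma continuous2_inner:
  assumes "continuous_on UNIV (\<lambda>(x, y). h x y :: real)"
  shows "continuous_on UNIV (\<lambda>x. integral {a..b} (h x :: real \<Rightarrow> real))"
proof -
  have "continuous_on UNIV (\<lambda>x. integral (cbox a b) (\<lambda>y. h x y))"
    by (rule integral_continuous_on_param) (rule continuous_on_subset[OF assms], simp)
  then show ?thesis by simp
qed

lemma continuous2_section:
  assumes "continuous_on UNIV (\<lambda>(x, y). h x y :: real)"
  shows "continuous_on S (h x)"
proof -
  have "continuous_on S (\<lambda>y. (x, y))" by (intro continuous_on_Pair continuous_on_const continuous_on_id)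
  from continuous_on_compose2[OF assms this] show ?thesis by simp
qed

lemma box_integral_add:
  assumes f: "continuous3 f" and g: "continuous3 g"
  shows "box_integral l u (\<lambda>x y t. f x y t + g x y t) = box_integral l u f + box_integral l u g"
proof -
  have i: "(h x y) integrable_on {a..b}" if "continuous3 h" for h x y a b
    by (rule integrable_continuous_interval) (rule continuous3_compose[OF that]; simp)
  have j: "(\<lambda>y. integral {a..b} (h x y)) integrable_on {c..d}" if "continuous3 h" for h x a b c d
    by (rule integrable_continuous_interval) (rule continuous2_section[OF continuous3_inner[OF that]])
  have k: "(\<lambda>x. integral {c..d} (\<lambda>y. integral {a..b} (h x y))) integrable_on {c'..d'}" if "continuous3 h" for h a b c d c' d'
    by (rule integrable_continuous_interval)
      (rule continuous_on_subset[OF continuous2_inner[OF continuous3_inner[OF that]]], simp)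
  show ?thesis unfolding box_integral_def
    by (simp add: integral_add i[OF f] i[OF g] j[OF f] j[OF g] k[OF f] k[OF g])
qed

lemma box_integral_cmult: "box_integral l u (\<lambda>x y t. k * f x y t) = k * box_integral l u f"
  unfolding box_integral_def by simp

lemma box_integral_prod:
  "box_integral l u (\<lambda>x y t. f x * g y * h t) =
    integral {l 1..u 1} f * integral {l 2..u 2} g * integral {l 3..u 3} h"
  unfolding box_integral_def by (simp add: mult.assoc)

lemma integral_derivative_eq_0:
  assumes "a \<le> b" "\<And>s. (F has_real_derivative f s) (at s)" "F a = 0" "F b = 0"
  shows "integral {a..b} f = 0"
proof -
  have "(f has_integral F b - F a) {a..b}"
    by (rule fundamental_theorem_of_calculus[OF assms(1)])
      (use assms(2) in \<open>auto simp: has_real_derivative_iff_has_vector_derivative[symmetric] intro: has_field_derivative_at_within\<close>)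
  then show ?thesis using assms by (simp add: integral_unique)
qed

lemma integral_swap_real:
  fixes h :: "real \<Rightarrow> real \<Rightarrow> real"
  assumes "continuous_on UNIV (\<lambda>(x, y). h x y)"
  shows "integral {a..b} (\<lambda>x. integral {c..d} (h x)) = integral {c..d} (\<lambda>y. integral {a..b} (\<lambda>x. h x y))"
  using integral_swap_continuous[of a c b d h] continuous_on_subset[OF assms] by simp

text \<open>Two interchanges bring the x-integration innermost, where the fundamental theorem of
  calculus applies.\<close>

lemma box_integral_derivative1:
  assumes l: "l 1 \<le> u 1" and D: "continuous3 D"
    and F: "\<And>x y t. ((\<lambda>s. F s y t) has_real_derivative D x y t) (at x)"
      "\<And>y t. F (l 1) y t = 0" "\<And>y t. F (u 1) y t = 0"
  shows "box_integral l u D = 0"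
proof -
  have xt: "continuous_on UNIV (\<lambda>(x, t). D x y t)" for y
    unfolding split_beta by (rule continuous3_compose[OF D]) (auto intro!: continuous_intros)
  have "box_integral l u D = integral {l 2..u 2} (\<lambda>y. integral {l 3..u 3} (\<lambda>t. integral {l 1..u 1} (\<lambda>x. D x y t)))"
    unfolding box_integral_def integral_swap_real[OF continuous3_inner[OF D]] integral_swap_real[OF xt] ..
  moreover have "integral {l 1..u 1} (\<lambda>x. D x y t) = 0" for y t
    by (rule integral_derivative_eq_0[OF l F(1)]) (rule F)+
  ultimately show ?thesis by simp
qed

lemma box_integral_derivative2:
  assumes l: "l 2 \<le> u 2" and D: "continuous3 D"
    and F: "\<And>x y t. ((\<lambda>s. F x s t) has_real_derivative D x y t) (at y)"
      "\<And>x t. F x (l 2) t = 0" "\<And>x t. F x (u 2) t = 0"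
  shows "box_integral l u D = 0"
proof -
  have yt: "continuous_on UNIV (\<lambda>(y, t). D x y t)" for x
    unfolding split_beta by (rule continuous3_compose[OF D]) (auto intro!: continuous_intros)
  have "integral {l 2..u 2} (\<lambda>y. D x y t) = 0" for x t
    by (rule integral_derivative_eq_0[OF l F(1)]) (rule F)+
  then show ?thesis unfolding box_integral_def integral_swap_real[OF yt] by simp
qed

lemma box_integral_derivative3:
  assumes l: "l 3 \<le> u 3"
    and F: "\<And>x y t. ((\<lambda>s. F x y s) has_real_derivative D x y t) (at t)"
      "\<And>x y. F x y (l 3) = 0" "\<And>x y. F x y (u 3) = 0"
  shows "box_integral l u D = 0"
proof -
  have "integral {l 3..u 3} (D x y) = 0" for x y
    by (rule integral_derivative_eq_0[OF l F(1)]) (rule F)+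
  then show ?thesis unfolding box_integral_def by simp
qed

section \<open>Divergences evaluated on separable functions\<close>

definition point3 :: "real \<Rightarrow> real \<Rightarrow> real \<Rightarrow> 3 \<Rightarrow> real" where
  "point3 x y t i = (if i = 1 then x else if i = 2 then y else t)"

lemma point3_simps [simp]: "point3 x y t 1 = x" "point3 x y t 2 = y" "point3 x y t 3 = t"
  by (simp_all add: point3_def)

lemma point3_upd: "(point3 x y t)(1 := s) = point3 s y t" "(point3 x y t)(2 := s) = point3 x s t"
  "(point3 x y t)(3 := s) = point3 x y s"
  by (auto simp: fun_eq_iff forall_3)

lemma continuous3_separable_jet:
  assumes "continuous_on UNIV G"
  shows "continuous3 (\<lambda>x y t. G (separable_jet f (point3 x y t)))"
proof -
  have "continuous_on UNIV (\<lambda>p. separable_jet f (point3 (fst p) (fst (snd p)) (snd (snd p))))"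
  proof (rule continuous_on_coordinatewise_then_product)
    fix c
    show "continuous_on UNIV (\<lambda>p. separable_jet f (point3 (fst p) (fst (snd p)) (snd (snd p))) c)"
    proof (cases c)
      case (Indep i)
      then show ?thesis using exhaust_3[of i] by (auto simp: separable_jet_def intro!: continuous_intros)
    next
      case (Deriv J)
      have "continuous_on UNIV (\<lambda>p. point3 (fst p) (fst (snd p)) (snd (snd p)) k)" for k
        using exhaust_3[of k] by (auto intro!: continuous_intros)
      then show ?thesis using Deriv
        by (auto simp: separable_jet_def intro!: continuous_on_prod continuous_on_poly)
    qed
  qed
  from continuous_on_compose2[OF assms this] show ?thesis
    unfolding continuous3_def split_beta by simp
qed

lemma separable_jet_0: "separable_jet (\<lambda>_. 0) p (Deriv J) = 0"
  by (simp add: separable_jet_def)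

text \<open>On a face normal to direction i every derivative in \<open>V\<close> contains a
  vanishing factor in the variable i, so the jet agrees on \<open>V\<close> with that of the zero
  function. Subtracting the zero function thus makes each flux component vanish on its two faces,
  although \<psi> itself need not vanish there.\<close>

lemma separable_jet_divergence_integral:
  assumes \<psi>: "\<And>i. differential_function (\<psi> i)" and lu: "\<And>i. l i \<le> u i"
    and V: "\<And>i. depends_on V (\<psi> i)"
    and f: "\<And>i J. Deriv J \<in> V \<Longrightarrow> poly ((pderiv ^^ count J i) (f i)) (l i) = 0"
      "\<And>i J. Deriv J \<in> V \<Longrightarrow> poly ((pderiv ^^ count J i) (f i)) (u i) = 0"
  shows "box_integral l u (\<lambda>x y t. (\<Sum>i\<in>UNIV. total_deriv i (\<psi> i) (separable_jet f (point3 x y t)))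
    - (\<Sum>i\<in>UNIV. total_deriv i (\<psi> i) (separable_jet (\<lambda>_. 0) (point3 x y t)))) = 0"
proof -
  define F where "F i x y t = \<psi> i (separable_jet f (point3 x y t)) - \<psi> i (separable_jet (\<lambda>_. 0) (point3 x y t))" for i x y t
  define D where "D i x y t = total_deriv i (\<psi> i) (separable_jet f (point3 x y t))
    - total_deriv i (\<psi> i) (separable_jet (\<lambda>_. 0) (point3 x y t))" for i x y t
  have face: "\<psi> i (separable_jet f p) = \<psi> i (separable_jet (\<lambda>_. 0) p)" if "p i = l i \<or> p i = u i" for i p
  proof (rule V[unfolded depends_on_def, rule_format])
    fix c assume c: "c \<in> V"
    show "separable_jet f p c = separable_jet (\<lambda>_. 0) p c"
    proof (cases c)
      case (Deriv J)
      have "poly ((pderiv ^^ count J i) (f i)) (p i) = 0" using that f c Deriv by auto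
      then have "separable_jet f p (Deriv J) = 0" by (auto simp: separable_jet_def)
      then show ?thesis by (simp add: Deriv separable_jet_0)
    qed (simp add: separable_jet_def)
  qed
  have cont: "continuous3 (D i)" for i
    using continuous3_separable_jet[OF continuous_on_total_deriv[OF \<psi>], of i i f]
      continuous3_separable_jet[OF continuous_on_total_deriv[OF \<psi>], of i i "\<lambda>_. 0"]
    by (auto simp: continuous3_def D_def[abs_def] split_beta intro!: continuous_intros)
  have D1: "((\<lambda>s. F 1 s y t) has_real_derivative D 1 x y t) (at x)" for x y t
    using DERIV_diff[OF separable_jet_DERIV[OF \<psi>[of 1], of f "point3 x y t" 1]
        separable_jet_DERIV[OF \<psi>[of 1], of "\<lambda>_. 0" "point3 x y t" 1]]
    by (simp add: F_def D_def point3_upd)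
  have D2: "((\<lambda>s. F 2 x s t) has_real_derivative D 2 x y t) (at y)" for x y t
    using DERIV_diff[OF separable_jet_DERIV[OF \<psi>[of 2], of f "point3 x y t" 2]
        separable_jet_DERIV[OF \<psi>[of 2], of "\<lambda>_. 0" "point3 x y t" 2]]
    by (simp add: F_def D_def point3_upd)
  have D3: "((\<lambda>s. F 3 x y s) has_real_derivative D 3 x y t) (at t)" for x y t
    using DERIV_diff[OF separable_jet_DERIV[OF \<psi>[of 3], of f "point3 x y t" 3]
        separable_jet_DERIV[OF \<psi>[of 3], of "\<lambda>_. 0" "point3 x y t" 3]]
    by (simp add: F_def D_def point3_upd)
  have "box_integral l u (D 1) = 0"
    by (rule box_integral_derivative1[OF lu cont D1]) (simp_all add: F_def face)
  moreover have "box_integral l u (D 2) = 0"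
    by (rule box_integral_derivative2[OF lu cont D2]) (simp_all add: F_def face)
  moreover have "box_integral l u (D 3) = 0"
    by (rule box_integral_derivative3[OF lu D3]) (simp_all add: F_def face)
  moreover have "continuous3 (\<lambda>x y t. D 1 x y t + D 2 x y t)"
    using cont[of 1] cont[of 2] by (auto simp: continuous3_def split_beta intro!: continuous_intros)
  ultimately have "box_integral l u (\<lambda>x y t. D 1 x y t + D 2 x y t + D 3 x y t) = 0"
    by (simp add: box_integral_add cont)
  then show ?thesis by (simp add: sum_3 D_def algebra_simps)
qed

section \<open>Polynomials vanishing to high order at the ends of an interval\<close>

lemma poly_funpow_pderiv_eq_0:
  fixes p :: "real poly"
  assumes "[:- a, 1:] ^ m dvd p" "k < m"
  shows "poly ((pderiv ^^ k) p) a = 0"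
proof -
  \<comment> \<open>Differentiation lowers the multiplicity of a root by at most one.\<close>
  have step: "[:- a, 1:] ^ n dvd pderiv q" if "[:- a, 1:] ^ Suc n dvd q" for n and q :: "real poly"
  proof -
    from that obtain r where r: "q = [:- a, 1:] ^ Suc n * r" by (elim dvdE)
    show ?thesis unfolding r pderiv_mult pderiv_power_Suc
    proof (rule dvd_add)
      show "[:- a, 1:] ^ n dvd [:- a, 1:] ^ Suc n * pderiv r"
        by (rule dvd_mult2[OF le_imp_power_dvd]) simp
      show "[:- a, 1:] ^ n dvd r * (smult (of_nat (Suc n)) ([:- a, 1:] ^ n) * pderiv [:- a, 1:])"
        by (intro dvd_mult dvd_mult2 dvd_smult dvd_refl)
    qed
  qed
  have "[:- a, 1:] ^ (m - k) dvd (pderiv ^^ k) p" using assms(2)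
  proof (induction k)
    case 0 then show ?case using assms(1) by simp
  next
    case (Suc k)
    then have "[:- a, 1:] ^ Suc (m - Suc k) dvd (pderiv ^^ k) p" by (simp add: Suc_diff_Suc)
    from step[OF this] show ?case by simp
  qed
  then have "[:- a, 1:] dvd (pderiv ^^ k) p"
    using assms(2) by (metis dvd_power dvd_trans zero_less_diff)
  then show ?thesis by (simp add: poly_eq_0_iff_dvd)
qed

definition bump :: "nat \<Rightarrow> real poly" where
  "bump n = ([:1, 1:] * [:1, -1:]) ^ n"

lemma poly_bump: "poly (bump n) x = (1 - x\<^sup>2) ^ n"
  by (simp add: bump_def poly_power algebra_simps power2_eq_square)

lemma bump_vanishes:
  assumes "k < n"
  shows "poly ((pderiv ^^ k) (bump n)) 1 = 0" "poly ((pderiv ^^ k) (bump n)) (- 1) = 0"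
proof -
  have "[:- 1, 1:] ^ n dvd bump n"
    unfolding bump_def power_mult_distrib
    by (intro dvd_mult) (rule dvd_power_same, rule dvdI[of _ _ "[:-1:]"], simp)
  moreover have "[:- (- 1), 1:] ^ n dvd bump n"
    unfolding bump_def power_mult_distrib by simp
  ultimately show "poly ((pderiv ^^ k) (bump n)) 1 = 0" "poly ((pderiv ^^ k) (bump n)) (- 1) = 0"
    using poly_funpow_pderiv_eq_0 assms by blast+
qed

lemma funpow_pderiv_pcompose:
  "(pderiv ^^ k) (pcompose p [:0, d:]) = smult (d ^ k) (pcompose ((pderiv ^^ k) p) [:0, d :: real:])"
  by (induction k) (simp_all add: pderiv_smult pderiv_pcompose pderiv_pCons mult.commute)

lemma integral_scale:
  fixes g :: "real \<Rightarrow> real"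
  assumes "continuous_on UNIV g" "d > 0"
  shows "integral {- 1 / d..1 / d} (\<lambda>t. g (d * t)) = integral {- 1..1} g / d"
proof -
  have "(g has_integral integral {-1..1} g) {-1..1}"
    by (intro integrable_integral integrable_continuous_interval continuous_on_subset[OF assms(1)]) simp
  from has_integral_stretch_real[OF this, of d] assms(2)
  have "((\<lambda>t. g (d * t)) has_integral integral {-1..1} g / d) ((\<lambda>x. x / d) ` {-1..1})" by simp
  moreover have "(\<lambda>x. x / d) ` {-1..1} = {- 1 / d..1 / d}"
    using assms(2) image_divide_atLeastAtMost[of d "-1" 1] by simp
  ultimately show ?thesis by (simp add: integral_unique)
qed

lemma integral_pos:
  fixes g :: "real \<Rightarrow> real"
  assumes "continuous_on UNIV g" "\<And>x. g x \<ge> 0" "g x0 \<noteq> 0" "a \<le> x0" "x0 \<le> b" "a < b"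
  shows "integral {a..b} g > 0"
proof -
  have c: "continuous_on {a..b} g" using assms(1) continuous_on_subset by blast
  have "integral {a..b} g \<noteq> 0" using integral_eq_0_iff[OF c assms(6)] assms by auto
  moreover have "integral {a..b} g \<ge> 0" using assms(2) by (intro integral_nonneg integrable_continuous_interval c)
  ultimately show ?thesis by simp
qed

lemma prod_3: "prod f (UNIV :: 3 set) = f 1 * f 2 * f 3"
  unfolding UNIV_3 by (simp add: mult.assoc)

lemma distinct_3: "(1::3) \<noteq> 2" "(2::3) \<noteq> 1" "(1::3) \<noteq> 3" "(3::3) \<noteq> 1" "(2::3) \<noteq> 3" "(3::3) \<noteq> 2"
  by simp_all
lemma separable_jet_first_order:
  "separable_jet f (point3 x y t) (Deriv {#}) = poly (f 1) x * poly (f 2) y * poly (f 3) t"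
  "separable_jet f (point3 x y t) (Deriv {#1#}) = poly (pderiv (f 1)) x * poly (f 2) y * poly (f 3) t"
  "separable_jet f (point3 x y t) (Deriv {#2#}) = poly (f 1) x * poly (pderiv (f 2)) y * poly (f 3) t"
  "separable_jet f (point3 x y t) (Deriv {#3#}) = poly (f 1) x * poly (f 2) y * poly (pderiv (f 3)) t"
  "separable_jet f (point3 x y t) (Indep i) = point3 x y t i"
  unfolding separable_jet_def prod_3
  by (simp_all only: jet_coord.case count_add_mset count_empty point3_simps distinct_3 if_False
      simp_thms if_True funpow.simps o_apply id_apply)

lemma continuous3_prod:
  assumes "continuous_on UNIV f" "continuous_on UNIV g" "continuous_on UNIV h"
  shows "continuous3 (\<lambda>x y t. f x * g y * h t)"
proof -
  have "continuous_on UNIV (\<lambda>p :: real \<times> real \<times> real. f (fst p))"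
    by (rule continuous_on_compose2[OF assms(1)]) (auto intro!: continuous_intros)
  moreover have "continuous_on UNIV (\<lambda>p :: real \<times> real \<times> real. g (fst (snd p)))"
    by (rule continuous_on_compose2[OF assms(2)]) (auto intro!: continuous_intros)
  moreover have "continuous_on UNIV (\<lambda>p :: real \<times> real \<times> real. h (snd (snd p)))"
    by (rule continuous_on_compose2[OF assms(3)]) (auto intro!: continuous_intros)
  ultimately show ?thesis unfolding continuous3_def split_beta by (intro continuous_on_mult)
qed

lemma continuous3_add: "continuous3 f \<Longrightarrow> continuous3 g \<Longrightarrow> continuous3 (\<lambda>x y t. f x y t + g x y t)"
  by (auto simp: continuous3_def split_beta intro!: continuous_intros)

lemma continuous3_cmult: "continuous3 f \<Longrightarrow> continuous3 (\<lambda>x y t. c * f x y t)"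
  by (auto simp: continuous3_def split_beta intro!: continuous_intros)

text \<open>For u = k(x) k(y) h(t) each term of the Lagrangian is a product of functions of one
  variable. The two mixed terms contain the integral of h h', which is zero by the end values of h;
  the rest pair up by the symmetry in x and y.\<close>

lemma heisenberg_lagrangian_separable_integral:
  fixes k h :: "real poly"
  defines "f \<equiv> \<lambda>i :: 3. if i = 3 then h else k"
  assumes h: "poly h (l 3) = 0" "poly h (u 3) = 0"
    and lu: "l 1 = a" "l 2 = a" "u 1 = b" "u 2 = b" "l 3 \<le> u 3"
  defines "A \<equiv> integral {a..b} (\<lambda>x. (poly (pderiv k) x)\<^sup>2)" and "B \<equiv> integral {a..b} (\<lambda>x. (poly k x)\<^sup>2)"
    and "M \<equiv> integral {a..b} (\<lambda>x. x\<^sup>2 * (poly k x)\<^sup>2)"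
  shows "box_integral l u (\<lambda>x y t. heisenberg_lagrangian (separable_jet f (point3 x y t))) =
    (A * B - 1/2 * B\<^sup>2) * integral {l 3..u 3} (\<lambda>t. (poly h t)\<^sup>2)
    + 4 * M * B * integral {l 3..u 3} (\<lambda>t. (poly (pderiv h) t)\<^sup>2)"
proof -
  let ?k' = "poly (pderiv k)" and ?h' = "poly (pderiv h)"
  have hh': "integral {l 3..u 3} (\<lambda>t. poly h t * ?h' t) = 0"
  proof (rule integral_derivative_eq_0[OF lu(5), where F = "\<lambda>t. (poly h t)\<^sup>2 / 2"])
    show "((\<lambda>t. (poly h t)\<^sup>2 / 2) has_real_derivative poly h s * ?h' s) (at s)" for s
      by (auto intro!: derivative_eq_intros poly_DERIV)
  qed (simp_all add: h)
  define P where "P f g h c = (\<lambda>x y t. c * (f x * g y * h t))" for f g h :: "real \<Rightarrow> real" and c :: real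
  have I: "box_integral l u (P f g h c) = c * (integral {a..b} f * integral {a..b} g * integral {l 3..u 3} h)" for f g h c
    unfolding P_def box_integral_cmult box_integral_prod lu ..
  have C: "continuous3 (P f g h c)" if "continuous_on UNIV f" "continuous_on UNIV g" "continuous_on UNIV h" for f g h c
    unfolding P_def by (intro continuous3_cmult continuous3_prod that)
  have pc: "continuous_on UNIV (poly p)" "continuous_on UNIV (\<lambda>x. (poly p x)\<^sup>2)" "continuous_on UNIV (\<lambda>x. x\<^sup>2 * (poly p x)\<^sup>2)"
    "continuous_on UNIV (\<lambda>x. poly p x * poly q x)" "continuous_on UNIV (\<lambda>x. x * (poly p x)\<^sup>2)" for p q :: "real poly"
    by (auto intro!: continuous_intros)
  have "box_integral l u (\<lambda>x y t. heisenberg_lagrangian (separable_jet f (point3 x y t))) =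
    box_integral l u (\<lambda>x y t. P (\<lambda>x. (?k' x)\<^sup>2) (\<lambda>y. (poly k y)\<^sup>2) (\<lambda>t. (poly h t)\<^sup>2) (1/2) x y t
      + P (\<lambda>x. (poly k x)\<^sup>2) (\<lambda>y. (?k' y)\<^sup>2) (\<lambda>t. (poly h t)\<^sup>2) (1/2) x y t
      + P (\<lambda>x. x\<^sup>2 * (poly k x)\<^sup>2) (\<lambda>y. (poly k y)\<^sup>2) (\<lambda>t. (?h' t)\<^sup>2) 2 x y t
      + P (\<lambda>x. (poly k x)\<^sup>2) (\<lambda>y. y\<^sup>2 * (poly k y)\<^sup>2) (\<lambda>t. (?h' t)\<^sup>2) 2 x y t
      + P (\<lambda>x. poly k x * ?k' x) (\<lambda>y. y * (poly k y)\<^sup>2) (\<lambda>t. poly h t * ?h' t) 2 x y t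
      + P (\<lambda>x. x * (poly k x)\<^sup>2) (\<lambda>y. poly k y * ?k' y) (\<lambda>t. poly h t * ?h' t) (-2) x y t
      + P (\<lambda>x. (poly k x)\<^sup>2) (\<lambda>y. (poly k y)\<^sup>2) (\<lambda>t. (poly h t)\<^sup>2) (-1/2) x y t)"
    by (rule arg_cong[of _ _ "box_integral l u"], intro ext)
      (simp add: heisenberg_lagrangian_def separable_jet_first_order f_def P_def power2_eq_square algebra_simps)
  also have "\<dots> = (A * B - 1/2 * B\<^sup>2) * integral {l 3..u 3} (\<lambda>t. (poly h t)\<^sup>2)
    + 4 * M * B * integral {l 3..u 3} (\<lambda>t. (?h' t)\<^sup>2)"
    by (simp add: box_integral_add continuous3_add C pc I hh' A_def[symmetric] B_def[symmetric] M_def[symmetric])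
      (simp add: algebra_simps power2_eq_square)
  finally show ?thesis .
qed

lemma heisenberg_lagrangian_not_divergence:
  assumes \<psi>: "\<And>i. differential_function (\<psi> i)"
  shows "\<not> (\<forall>z. heisenberg_lagrangian z = (\<Sum>i\<in>UNIV. total_deriv i (\<psi> i) z))"
proof
  assume L: "\<forall>z. heisenberg_lagrangian z = (\<Sum>i\<in>UNIV. total_deriv i (\<psi> i) z)"
  have "\<forall>i. \<exists>V. finite V \<and> depends_on V (\<psi> i)" using \<psi> by (simp add: differential_function_def)
  then obtain W where W: "\<And>i. finite (W i)" "\<And>i. depends_on (W i) (\<psi> i)" by metis
  define V where "V = (\<Union>i. W i)"
  have V: "finite V" "\<And>i. depends_on V (\<psi> i)"
    using W by (auto simp: V_def intro: depends_on_mono)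
  \<comment> \<open>Larger than the order of every derivative in the flux, and positive, so that the
    test polynomial itself vanishes at the ends.\<close>
  define n where "n = Suc (\<Sum>J | Deriv J \<in> V. size J)"
  have n: "count J i < n" if "Deriv J \<in> V" for i J
  proof -
    have "size J \<le> (\<Sum>J | Deriv J \<in> V. size J)"
      by (rule member_le_sum) (use that finite_Deriv_indices[OF V(1)] in auto)
    then show ?thesis using count_le_size[of J i] by (simp add: n_def)
  qed
  let ?k = "bump n"
  define A where "A = integral {-1..1} (\<lambda>x. (poly (pderiv ?k) x)\<^sup>2)"
  define B where "B = integral {-1..1} (\<lambda>x. (poly ?k x)\<^sup>2)"
  define M where "M = integral {-1..1} (\<lambda>x. x\<^sup>2 * (poly ?k x)\<^sup>2)"
  \<comment> \<open>With h(t) = k(d t) on [-1/d, 1/d], the integral of h^2 is B / d and that of h'^2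
    is d A.\<close>
  have scaled: "(A * B - 1/2 * B\<^sup>2) * (B / d) + 4 * M * B * (d * A) = 0" if d: "d > 0" for d
  proof -
    define h where "h = pcompose ?k [:0, d:]"
    define l where "l i = (if i = 3 then - 1 / d else - 1)" for i :: 3
    define u where "u i = (if i = 3 then 1 / d else 1)" for i :: 3
    define f where "f i = (if i = 3 then h else ?k)" for i :: 3
    have h_ends: "poly ((pderiv ^^ m) h) (- 1 / d) = 0" "poly ((pderiv ^^ m) h) (1 / d) = 0" if "m < n" for m
      using bump_vanishes[OF that] d by (simp_all add: h_def funpow_pderiv_pcompose poly_pcompose)
    have "box_integral l u (\<lambda>x y t. (\<Sum>i\<in>UNIV. total_deriv i (\<psi> i) (separable_jet f (point3 x y t)))
      - (\<Sum>i\<in>UNIV. total_deriv i (\<psi> i) (separable_jet (\<lambda>_. 0) (point3 x y t)))) = 0"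
    proof (rule separable_jet_divergence_integral[OF \<psi> _ V(2)])
      show "l i \<le> u i" for i using d by (simp add: l_def u_def)
    next
      fix i J assume J: "Deriv J \<in> V"
      show "poly ((pderiv ^^ count J i) (f i)) (l i) = 0" "poly ((pderiv ^^ count J i) (f i)) (u i) = 0"
        using h_ends[OF n[OF J]] bump_vanishes[OF n[OF J]] by (simp_all add: f_def l_def u_def)
    qed
    \<comment> \<open>The subtracted divergence is the Lagrangian of the zero function, hence
      zero.\<close>
    moreover have "heisenberg_lagrangian (separable_jet (\<lambda>_. 0) p) = 0" for p
      by (simp add: heisenberg_lagrangian_def separable_jet_0)
    ultimately have "box_integral l u (\<lambda>x y t. heisenberg_lagrangian (separable_jet f (point3 x y t))) = 0"
      by (simp add: L[rule_format, symmetric])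
    moreover have "box_integral l u (\<lambda>x y t. heisenberg_lagrangian (separable_jet f (point3 x y t))) =
      (A * B - 1/2 * B\<^sup>2) * integral {l 3..u 3} (\<lambda>t. (poly h t)\<^sup>2)
      + 4 * M * B * integral {l 3..u 3} (\<lambda>t. (poly (pderiv h) t)\<^sup>2)"
      unfolding A_def B_def M_def f_def
      by (rule heisenberg_lagrangian_separable_integral)
        (use h_ends[of 0] d in \<open>auto simp: l_def u_def n_def\<close>)
    moreover have "integral {l 3..u 3} (\<lambda>t. (poly h t)\<^sup>2) = B / d"
      using integral_scale[OF _ d, of "\<lambda>x. (poly ?k x)\<^sup>2"]
      by (simp add: B_def h_def l_def u_def poly_pcompose continuous_intros mult.commute)
    moreover have "integral {l 3..u 3} (\<lambda>t. (poly (pderiv h) t)\<^sup>2) = d * A"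
    proof -
      have "(poly (pderiv h) t)\<^sup>2 = d\<^sup>2 * (poly (pderiv ?k) (d * t))\<^sup>2" for t
        using funpow_pderiv_pcompose[of 1 ?k d] by (simp add: h_def poly_pcompose power_mult_distrib mult.commute)
      then show ?thesis
        using integral_scale[OF _ d, of "\<lambda>x. (poly (pderiv ?k) x)\<^sup>2"] d
        by (simp add: A_def l_def u_def continuous_intros power2_eq_square)
    qed
    ultimately show ?thesis by simp
  qed
  have "B > 0" unfolding B_def
    by (rule integral_pos[of _ 0]) (auto simp: poly_bump intro!: continuous_intros)
  moreover have "M > 0" unfolding M_def
    \<comment> \<open>The integrand is zero at 0 because of the factor x^2, so positivity is
      witnessed at 1/2.\<close>
    by (rule integral_pos[of _ "1/2"]) (auto simp: poly_bump power2_eq_square intro!: continuous_intros)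
  moreover have "A > 0"
  proof -
    have "\<exists>x>-1. x < 0 \<and> poly ?k 0 - poly ?k (-1) = (0 - (-1)) * poly (pderiv ?k) x"
      by (rule MVT2) (auto intro: poly_DERIV)
    then obtain x where "x > -1" "x < 0" "poly (pderiv ?k) x \<noteq> 0"
      by (auto simp: poly_bump n_def)
    then show ?thesis unfolding A_def
      by (intro integral_pos[of _ x]) (auto intro!: continuous_intros)
  qed
  moreover have "M * B * A = 0"
  proof -
    define P Q where "P = (A * B - 1/2 * B\<^sup>2) * B" and "Q = M * B * A"
    have "P / d + 4 * Q * d = 0" if "d > 0" for d
      using scaled[OF that] by (simp add: P_def Q_def mult_ac)
    \<comment> \<open>The sign of P is not known. The equations P + 4 Q = 0 and P / 2 + 8 Q = 0
      eliminate it and leave Q = 0.\<close>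
    from this[of 1] this[of 2] have "Q = 0" by simp
    then show ?thesis by (simp add: Q_def)
  qed
  ultimately show False by simp
qed

theorem theorem3:
  shows "{S. noether_symmetry heisenberg_eq heisenberg_lagrangian S} =
    lie_algebra_generated
      ({T_field, R_field, X_tilde, Y_tilde} \<union>
       {W_field \<beta> | \<beta>. base_function \<beta> \<and> (\<forall>z. kohn_laplace \<beta> z + \<beta> z = 0)})"
  unfolding lie_algebra_generated_heis
proof (intro subset_antisym subsetI)
  fix S assume "S \<in> heis_algebra"
  then show "S \<in> {S. noether_symmetry heisenberg_eq heisenberg_lagrangian S}"
    unfolding heis_algebra_def by (auto intro: heis_field_noether)
next
  fix S assume "S \<in> {S. noether_symmetry heisenberg_eq heisenberg_lagrangian S}"
  then obtain \<phi> where lie: "lie_point_symmetry heisenberg_eq S" and \<phi>: "\<And>i. differential_function (\<phi> i)"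
    and div: "\<And>z. pr1 S heisenberg_lagrangian z + heisenberg_lagrangian z * (\<Sum>i\<in>UNIV. total_deriv i (xi S i) z) =
             (\<Sum>i\<in>UNIV. total_deriv i (\<phi> i) z)"
    unfolding noether_symmetry_def by auto
  obtain c0 r c1 c2 \<kappa> \<beta> where
    S: "xi S 1 = (\<lambda>z. r * yc z + c1)" "xi S 2 = (\<lambda>z. - r * xc z + c2)"
    "xi S 3 = (\<lambda>z. c0 - 2 * c1 * yc z + 2 * c2 * xc z)" "eta S = (\<lambda>z. \<kappa> * uc z + \<beta> z)" and
    \<beta>: "base_function \<beta>" "\<And>z. sublaplacian \<beta> z + \<beta> z = 0"
    by (rule lie_point_symmetry_classification[OF lie]) (rule that)
  have S': "S = heis_field c0 r c1 c2 (\<lambda>z. \<kappa> * uc z + \<beta> z)"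
    by (rule vector_field_eqI) (simp_all add: S)
  have h: "point_function (\<lambda>z. \<kappa> * uc z + \<beta> z)"
    using lie by (simp add: lie_point_symmetry_def point_vector_field_def S(4)[symmetric])
  obtain \<phi>' :: "3 \<Rightarrow> jet \<Rightarrow> real" where \<phi>': "\<And>i. differential_function (\<phi>' i)"
    and div': "\<And>z. (\<Sum>i\<in>UNIV. total_deriv i (\<phi>' i) z) =
      HX \<beta> z * (z (Deriv {#1#}) + 2 * yc z * z (Deriv {#3#})) + HY \<beta> z * (z (Deriv {#2#}) - 2 * xc z * z (Deriv {#3#}))
      - \<beta> z * uc z" by (rule divergence_green[OF \<beta>]) (rule that)
  \<comment> \<open>\<open>HX\<close> and \<open>HY\<close> use partial derivatives on the jet
    space, so u counts as a constant; its derivative enters only through the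
    \<open>pd (Deriv {#})\<close> term.\<close>
  have uc: "HX uc = (\<lambda>z. 0)" "HY uc = (\<lambda>z. 0)" by (auto simp: HX_def HY_def)
  have "2 * \<kappa> * heisenberg_lagrangian z = (\<Sum>i\<in>UNIV. total_deriv i (\<phi> i) z) - (\<Sum>i\<in>UNIV. total_deriv i (\<phi>' i) z)" for z
    unfolding div[symmetric] S' pr1_heis_field_lagrangian[OF h] div'
    using \<beta>(1) by (simp add: base_function_smooth uc heisenberg_lagrangian_def algebra_simps power2_eq_square)
  then have L: "2 * \<kappa> * heisenberg_lagrangian z = (\<Sum>i\<in>UNIV. total_deriv i (\<phi> i) z - total_deriv i (\<phi>' i) z)" for z
    by (simp add: sum_subtractf)
  have "\<kappa> = 0"
  proof (rule ccontr)
    assume \<kappa>: "\<kappa> \<noteq> 0"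
    define c where "c = 1 / (2 * \<kappa>)"
    define \<psi> where "\<psi> i = (\<lambda>z. c * (\<phi> i z - \<phi>' i z))" for i
    have "differential_function (\<psi> i)" for i using \<phi> \<phi>' unfolding \<psi>_def by simp
    moreover have "heisenberg_lagrangian z = (\<Sum>i\<in>UNIV. total_deriv i (\<psi> i) z)" for z
    proof -
      have "total_deriv i (\<psi> i) z = c * (total_deriv i (\<phi> i) z - total_deriv i (\<phi>' i) z)" for i
        unfolding \<psi>_def by (subst total_deriv_mult) (simp_all add: \<phi> \<phi>')
      then have "(\<Sum>i\<in>UNIV. total_deriv i (\<psi> i) z) = c * (2 * \<kappa> * heisenberg_lagrangian z)"
        unfolding L by (simp add: sum_distrib_left)
      then show ?thesis using \<kappa> by (simp add: c_def)
    qed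
    ultimately show False using heisenberg_lagrangian_not_divergence[of \<psi>] by blast
  qed
  then have "S = heis_field c0 r c1 c2 \<beta>" using S' by simp
  then show "S \<in> heis_algebra" using \<beta> unfolding heis_algebra_def by blast
qed

end
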